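(* If $n-d\ll d$ as $n\to\infty$, then for every fixed $r>0$, $$ F_{[-1,-r/\sqrt d]}\to0\qquad\text{and}\qquad F_{[r/\sqrt d,1]}\to0. $$
   Context: Asymptotic setting: $\mathbb{N}\ni n\to\infty$ and $d=d(n)\in\{2,\ldots,n-1\}$ is a function of $n$ which is either constant or tends to infinity. All limits are as $n\to\infty$. The notation $f\ll g$ means $f(n)/g(n)\to0$. Let $X_1,\ldots,X_n$ be i.i.d. random vectors uniformly distributed on the unit sphere $\mathbb{S}^{d-1}\subset\mathbb{R}^d$, and let $P_{n,d}=[X_1,\ldots,X_n]$ be their convex hull. A facet ($(d-1)$-dimensional face) of $P_{n,d}$ has height $h\in[-1,1]$ if its supporting hyperplane is $\{x\in\mathbb{R}^d:\langle x,u\rangle=h\}$ for some $u\in\mathbb{S}^{d-1}$ and $P_{n,d}\subset\{x:\langle x,u\rangle\le h\}$ (heights can be negative). For $-1\le h_1\le h_2\le1$, $F_{[h_1,h_2]}=\mathbb{E}\,\#\{\text{facets of }P_{n,d}\text{ with height in }[h_1,h_2]\}$. *)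

theory Defs
  imports "HOL-Probability.Probability" "HOL-Library.Function_Algebras"
begin

text \<open>
  The dimension varies with the number of points, so it cannot be a type parameter. All the
  spaces \<open>\<real>\<^sup>d\<close> are realised inside the single real vector space \<^typ>\<open>nat \<Rightarrow> real\<close> as the
  subspaces of functions vanishing outside \<open>{..<d}\<close>. The pointwise vector space structure
  makes \<^const>\<open>convex\<close>, \<^const>\<open>hull\<close>, \<^const>\<open>affine_dependent\<close> and \<^const>\<open>face_of\<close> available.
\<close>

instantiation "fun" :: (type, real_vector) real_vector
begin

definition scaleR_fun :: "real \<Rightarrow> ('a \<Rightarrow> 'b) \<Rightarrow> 'a \<Rightarrow> 'b" where
  "scaleR_fun c f = (\<lambda>x. c *\<^sub>R f x)"

instance
  by standard (simp_all add: scaleR_fun_def fun_eq_iff scaleR_add_right scaleR_add_left)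

end

definition Rdim :: "nat \<Rightarrow> (nat \<Rightarrow> real) set" where
  "Rdim d = {x. \<forall>i\<ge>d. x i = 0}"

definition ip :: "nat \<Rightarrow> (nat \<Rightarrow> real) \<Rightarrow> (nat \<Rightarrow> real) \<Rightarrow> real" where
  "ip d x y = (\<Sum>i<d. x i * y i)"

definition usphere :: "nat \<Rightarrow> (nat \<Rightarrow> real) set" where
  "usphere d = {x \<in> Rdim d. ip d x x = 1}"

definition uball :: "nat \<Rightarrow> (nat \<Rightarrow> real) set" where
  "uball d = {x \<in> Rdim d. ip d x x \<le> 1}"

text \<open>
  Lebesgue measure of \<open>\<real>\<^sup>d\<close>, transported to \<^typ>\<open>nat \<Rightarrow> real\<close> by extension with zeros (elements of
  the space of the product measure are \<^const>\<open>undefined\<close> outside \<open>{..<d}\<close>).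
\<close>

definition lebesgue_Rdim :: "nat \<Rightarrow> (nat \<Rightarrow> real) measure" where
  "lebesgue_Rdim d = distr (Pi\<^sub>M {..<d} (\<lambda>_. lborel)) borel (\<lambda>x i. if i < d then x i else 0)"

text \<open>
  The uniform distribution on the sphere (normalised surface measure): a set \<open>A\<close> of directions
  receives the proportion of the volume of the unit ball that is taken up by the cone over \<open>A\<close>.
\<close>

definition uniform_usphere :: "nat \<Rightarrow> (nat \<Rightarrow> real) measure" where
  "uniform_usphere d =
     distr (uniform_measure (lebesgue_Rdim d) (uball d)) borel (\<lambda>x. x /\<^sub>R sqrt (ip d x x))"

text \<open>
  \<^const>\<open>aff_dim\<close> is restricted to Euclidean spaces; this is the same notion for a set of
  affine dimension \<open>k\<close> in an arbitrary real vector space.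
\<close>

definition has_aff_dim :: "'a::real_vector set \<Rightarrow> int \<Rightarrow> bool" where
  "has_aff_dim S k \<longleftrightarrow>
     (\<exists>B. finite B \<and> affine hull B = affine hull S \<and> \<not> affine_dependent B \<and> int (card B) = k + 1)"

definition facet_with_height ::
    "nat \<Rightarrow> (nat \<Rightarrow> real) set \<Rightarrow> real \<Rightarrow> (nat \<Rightarrow> real) set \<Rightarrow> bool" where
  "facet_with_height d P h T \<longleftrightarrow>
     T face_of P \<and> has_aff_dim T (int d - 1) \<and>
     (\<exists>u\<in>usphere d. T = P \<inter> {x. ip d x u = h} \<and> P \<subseteq> {x. ip d x u \<le> h})"

text \<open>
  The expectation is a non-negative integral, in \<^typ>\<open>ennreal\<close>: it is monotone and, unlike the
  Bochner integral, does not collapse to \<open>0\<close> on a function not known to be measurable. A polytope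
  has finitely many faces, so \<^const>\<open>card\<close> is the true number of facets.
\<close>

definition expected_facets ::
    "'w measure \<Rightarrow> (nat \<Rightarrow> 'w \<Rightarrow> nat \<Rightarrow> real) \<Rightarrow> nat \<Rightarrow> nat \<Rightarrow> real \<Rightarrow> real \<Rightarrow> ennreal" where
  "expected_facets M X n d h1 h2 =
     (\<integral>\<^sup>+ \<omega>. of_nat (card {T. \<exists>h\<in>{h1..h2}.
        facet_with_height d (convex hull ((\<lambda>i. X i \<omega>) ` {..<n})) h T}) \<partial>M)"

text \<open>The sphere measure is well defined: a probability measure concentrated on the sphere.\<close>

lemma borel_measurable_ip [measurable]: "(\<lambda>x. ip d x x) \<in> borel_measurable borel"
  unfolding ip_def by measurable

lemma sets_Rdim [measurable]: "Rdim d \<in> sets borel"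
proof -
  have "Rdim d = (\<Inter>i\<in>{d..}. {x. x i = 0})"
    by (auto simp: Rdim_def)
  also have "\<dots> \<in> sets borel"
    by measurable
  finally show ?thesis .
qed

lemma sets_uball [measurable]: "uball d \<in> sets borel"
  unfolding uball_def by measurable

lemma sets_usphere [measurable]: "usphere d \<in> sets borel"
  unfolding usphere_def by measurable

lemma measurable_extend0 [measurable]:
  "(\<lambda>x i. if i < d then x i else 0) \<in> Pi\<^sub>M {..<d} (\<lambda>_. lborel) \<rightarrow>\<^sub>M (borel :: (nat \<Rightarrow> real) measure)"
proof (rule measurable_coordinatewise_then_product)
  fix i
  show "(\<lambda>x. if i < d then x i else 0) \<in> borel_measurable (Pi\<^sub>M {..<d} (\<lambda>_. lborel))"
    by (cases "i < d") simp_all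
qed

lemma measurable_normalise [measurable]:
  "(\<lambda>x. x /\<^sub>R sqrt (ip d x x)) \<in> borel \<rightarrow>\<^sub>M borel"
proof (rule measurable_coordinatewise_then_product)
  fix i
  show "(\<lambda>x. (x /\<^sub>R sqrt (ip d x x)) i) \<in> borel_measurable borel"
    unfolding scaleR_fun_def by measurable
qed

lemma sets_lebesgue_Rdim [simp, measurable_cong]: "sets (lebesgue_Rdim d) = sets borel"
  by (simp add: lebesgue_Rdim_def)

lemma emeasure_box:
  "emeasure (Pi\<^sub>M {..<d} (\<lambda>_. lborel)) (Pi\<^sub>E {..<d} (\<lambda>_. {a..b})) = (emeasure lborel {a..b::real}) ^ d"
proof -
  interpret product_sigma_finite "\<lambda>_::nat. lborel :: real measure" ..
  show ?thesis
    by (subst emeasure_PiM) auto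
qed

lemma emeasure_uball_finite: "emeasure (lebesgue_Rdim d) (uball d) < \<infinity>"
proof -
  have "emeasure (lebesgue_Rdim d) (uball d) =
      emeasure (Pi\<^sub>M {..<d} (\<lambda>_. lborel))
        ((\<lambda>x i. if i < d then x i else 0) -` uball d \<inter> space (Pi\<^sub>M {..<d} (\<lambda>_. lborel)))"
    unfolding lebesgue_Rdim_def by (rule emeasure_distr) measurable
  also have "\<dots> \<le> emeasure (Pi\<^sub>M {..<d} (\<lambda>_. lborel)) (Pi\<^sub>E {..<d} (\<lambda>_. {-1..1::real}))"
  proof (rule emeasure_mono)
    show "(\<lambda>x i. if i < d then x i else 0) -` uball d \<inter> space (Pi\<^sub>M {..<d} (\<lambda>_. lborel))
        \<subseteq> Pi\<^sub>E {..<d} (\<lambda>_. {-1..1::real})"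
    proof
      fix x
      assume x: "x \<in> (\<lambda>x i. if i < d then x i else 0) -` uball d \<inter> space (Pi\<^sub>M {..<d} (\<lambda>_. lborel))"
      then have s: "(\<Sum>i<d. x i * x i) \<le> 1"
        by (simp add: uball_def ip_def)
      have "x i \<in> {-1..1}" if "i < d" for i
      proof -
        have "x i * x i \<le> (\<Sum>i<d. x i * x i)"
          using that by (intro member_le_sum) auto
        with s have "(x i)\<^sup>2 \<le> 1"
          by (simp add: power2_eq_square)
        then show ?thesis
          using abs_le_square_iff[of "x i" 1] by auto
      qed
      with x show "x \<in> Pi\<^sub>E {..<d} (\<lambda>_. {-1..1::real})"
        by (auto simp: space_PiM PiE_iff)
    qed
  qed (auto intro!: sets_PiM_I_finite)
  also have "\<dots> < \<infinity>"
    by (simp add: emeasure_box ennreal_power flip: ennreal_numeral)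
  finally show ?thesis .
qed

lemma emeasure_uball_pos:
  assumes "0 < d"
  shows "0 < emeasure (lebesgue_Rdim d) (uball d)"
proof -
  define c where "c = 1 / real d"
  have c: "0 < c" "c \<le> 1" "real d * c = 1"
    using assms by (auto simp: c_def)
  have "0 < emeasure (Pi\<^sub>M {..<d} (\<lambda>_. lborel)) (Pi\<^sub>E {..<d} (\<lambda>_. {0..c}))"
    using c by (simp add: emeasure_box ennreal_power)
  also have "\<dots> \<le> emeasure (Pi\<^sub>M {..<d} (\<lambda>_. lborel))
        ((\<lambda>x i. if i < d then x i else 0) -` uball d \<inter> space (Pi\<^sub>M {..<d} (\<lambda>_. lborel)))"
  proof (rule emeasure_mono)
    show "Pi\<^sub>E {..<d} (\<lambda>_. {0..c})
      \<subseteq> (\<lambda>x i. if i < d then x i else 0) -` uball d \<inter> space (Pi\<^sub>M {..<d} (\<lambda>_. lborel))"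
    proof
      fix x :: "nat \<Rightarrow> real"
      assume x: "x \<in> Pi\<^sub>E {..<d} (\<lambda>_. {0..c})"
      have "x i * x i \<le> c" if "i < d" for i
      proof -
        have "0 \<le> x i" "x i \<le> c"
          using x that by (auto simp: PiE_iff)
        then have "x i * x i \<le> c * 1"
          using c by (intro mult_mono) auto
        then show ?thesis by simp
      qed
      then have "(\<Sum>i<d. x i * x i) \<le> (\<Sum>i<d. c)"
        by (intro sum_mono) auto
      with c x show "x \<in> (\<lambda>x i. if i < d then x i else 0) -` uball d \<inter> space (Pi\<^sub>M {..<d} (\<lambda>_. lborel))"
        by (auto simp: uball_def Rdim_def ip_def space_PiM PiE_iff)
    qed
    show "(\<lambda>x i. if i < d then x i else 0) -` uball d \<inter> space (Pi\<^sub>M {..<d} (\<lambda>_. lborel))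
        \<in> sets (Pi\<^sub>M {..<d} (\<lambda>_. lborel))"
      by measurable
  qed
  also have "\<dots> = emeasure (lebesgue_Rdim d) (uball d)"
    unfolding lebesgue_Rdim_def by (rule emeasure_distr[symmetric]) measurable
  finally show ?thesis .
qed

lemma prob_space_uniform_usphere:
  assumes "0 < d"
  shows "prob_space (uniform_usphere d)"
proof -
  interpret prob_space "uniform_measure (lebesgue_Rdim d) (uball d)"
    using emeasure_uball_pos[OF assms] emeasure_uball_finite[of d]
    by (intro prob_space_uniform_measure) auto
  show ?thesis
    unfolding uniform_usphere_def
    by (rule prob_space_distr) measurable
qed

lemma AE_uniform_usphere:
  assumes "0 < d"
  shows "AE x in uniform_usphere d. x \<in> usphere d"
proof -
  interpret product_sigma_finite "\<lambda>_::nat. lborel :: real measure" ..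
  have null: "AE x in lebesgue_Rdim d. x \<noteq> 0"
  proof (rule AE_I)
    show "{x \<in> space (lebesgue_Rdim d). \<not> x \<noteq> 0} \<subseteq> {x \<in> space borel. \<forall>i. x i = (0::real)}"
      by (auto simp: zero_fun_def)
    have "emeasure (lebesgue_Rdim d) {x \<in> space borel. \<forall>i. x i = (0::real)} =
      emeasure (Pi\<^sub>M {..<d} (\<lambda>_. lborel)) ((\<lambda>x i. if i < d then x i else 0) -`
        {x \<in> space borel. \<forall>i. x i = (0::real)} \<inter> space (Pi\<^sub>M {..<d} (\<lambda>_. lborel)))"
      unfolding lebesgue_Rdim_def by (rule emeasure_distr) measurable
    also have "\<dots> \<le> emeasure (Pi\<^sub>M {..<d} (\<lambda>_. lborel)) (Pi\<^sub>E {..<d} (\<lambda>_. {0..0::real}))"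
    proof (rule emeasure_mono)
      show "(\<lambda>x i. if i < d then x i else 0) -` {x \<in> space borel. \<forall>i. x i = (0::real)}
          \<inter> space (Pi\<^sub>M {..<d} (\<lambda>_. lborel)) \<subseteq> Pi\<^sub>E {..<d} (\<lambda>_. {0..0})"
        by (auto simp: space_PiM PiE_iff split: if_splits simp del: atLeastAtMost_singleton PiE_singleton)
    qed (intro sets_PiM_I_finite, auto)
    also have "\<dots> = 0"
      using assms by (simp only: emeasure_box) simp
    finally show "emeasure (lebesgue_Rdim d) {x \<in> space borel. \<forall>i. x i = (0::real)} = 0"
      by simp
    show "{x \<in> space borel. \<forall>i. x i = (0::real)} \<in> sets (lebesgue_Rdim d)"
      unfolding sets_lebesgue_Rdim by measurable
  qed
  have in_sphere: "x /\<^sub>R sqrt (ip d x x) \<in> usphere d" if "x \<in> uball d" "x \<noteq> 0" for x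
  proof -
    have "x \<in> Rdim d"
      using that by (simp add: uball_def)
    from that obtain i where i: "x i \<noteq> 0"
      by (auto simp: zero_fun_def)
    with \<open>x \<in> Rdim d\<close> have "i < d"
      by (auto simp: Rdim_def not_le[symmetric])
    with i have pos: "0 < ip d x x"
      unfolding ip_def by (intro sum_pos2[of _ i]) (auto simp: zero_less_mult_iff not_less)
    have "ip d (x /\<^sub>R sqrt (ip d x x)) (x /\<^sub>R sqrt (ip d x x))
        = (\<Sum>i<d. (x i * x i) / ip d x x)"
      unfolding ip_def[of d "x /\<^sub>R sqrt (ip d x x)"] unfolding scaleR_fun_def
    proof (rule sum.cong)
      fix i
      have "sqrt (ip d x x) * sqrt (ip d x x) = ip d x x"
        using pos by simp
      then show "(x i /\<^sub>R sqrt (ip d x x)) * (x i /\<^sub>R sqrt (ip d x x)) = (x i * x i) / ip d x x"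
        by (simp add: field_simps)
    qed simp
    also have "\<dots> = ip d x x / ip d x x"
      unfolding ip_def by (rule sum_divide_distrib[symmetric])
    also have "\<dots> = 1"
      using pos by simp
    finally show ?thesis
      using \<open>x \<in> Rdim d\<close> by (auto simp: usphere_def Rdim_def scaleR_fun_def)
  qed
  have "AE x in uniform_measure (lebesgue_Rdim d) (uball d). x /\<^sub>R sqrt (ip d x x) \<in> usphere d"
  proof (rule AE_uniform_measureI)
    show "uball d \<in> sets (lebesgue_Rdim d)"
      by simp
    show "AE x in lebesgue_Rdim d. x \<in> uball d \<longrightarrow> x /\<^sub>R sqrt (ip d x x) \<in> usphere d"
      using null by eventually_elim (blast intro: in_sphere)
  qed
  then show ?thesis
    unfolding uniform_usphere_def by (subst AE_distr_iff) auto
qed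

end

theory Submission
  imports Defs "HOL-Combinatorics.Permutations"
begin

text \<open>
  A facet of height \<open>h \<noteq> 0\<close> with outer normal \<open>u\<close> is determined by \<open>d\<close> linearly independent vertices
  \<open>x\<^sub>0, \<dots>, x\<^sub>d\<^sub>-\<^sub>1\<close> on it, and \<open>y = u / h\<close> solves \<open>\<langle>x\<^sub>i, y\<rangle> = 1\<close> with \<open>\<bar>y\<bar>\<^sup>2 = 1 / h\<^sup>2\<close>. So the expected number of
  facets of height at least \<open>r / sqrt d\<close> in absolute value is at most \<open>n choose d\<close> times the probability
  that \<open>d\<close> random points admit a solution with \<open>\<bar>y\<bar>\<^sup>2 \<le> d / r\<^sup>2\<close>. Since the binomial coefficient is
  \<open>exp (o(d))\<close> when \<open>n - d \<ll> d\<close>, it suffices that this probability is exponentially small in \<open>d\<close>.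

  Let \<open>z\<^sub>k\<close> be the component of \<open>x\<^sub>k\<close> orthogonal to its predecessors and \<open>y\<^sub>k\<close> the shortest solution
  of the first \<open>k\<close> equations. Then
  \<open>\<bar>y\<^sub>k\<^sub>+\<^sub>1\<bar>\<^sup>2 = \<bar>y\<^sub>k\<bar>\<^sup>2 + (1 - \<langle>x\<^sub>k, y\<^sub>k\<rangle>)\<^sup>2 / \<bar>z\<^sub>k\<bar>\<^sup>2\<close>. Given the past, \<open>\<bar>z\<^sub>k\<bar>\<^sup>2\<close> has mean \<open>(d - k) / d\<close> and is
  unchanged under \<open>x\<^sub>k \<mapsto> - x\<^sub>k\<close>, so that with probability at least \<open>1 / 4\<close> the increment is at least
  \<open>d / (2 (d - k))\<close>. These lower bounds add up to the order \<open>d ln d\<close>, and a Chernoff bound with a small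
  constant parameter \<open>\<mu>\<close> finishes the proof.
\<close>

subsection \<open>Gram--Schmidt and the shortest solution\<close>

lemma ip_commute: "ip d x y = ip d y x"
  by (simp add: ip_def mult.commute)

lemma ip_add_left: "ip d (x + y) z = ip d x z + ip d y z"
  by (simp add: ip_def distrib_right sum.distrib)

lemma ip_diff_left: "ip d (x - y) z = ip d x z - ip d y z"
  by (simp add: ip_def left_diff_distrib sum_subtractf)

lemma ip_scaleR_left: "ip d (c *\<^sub>R x) z = c * ip d x z"
  by (simp add: ip_def scaleR_fun_def sum_distrib_left mult.assoc)

lemma ip_zero_left [simp]: "ip d 0 z = 0"
  by (simp add: ip_def)

lemma ip_sum_left: "ip d (\<Sum>i\<in>A. f i) z = (\<Sum>i\<in>A. ip d (f i) z)"
  by (induction A rule: infinite_finite_induct)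
    (simp_all only: sum.infinite sum.empty sum.insert ip_zero_left ip_add_left not_False_eq_True)

lemma ip_diff_right: "ip d z (x - y) = ip d z x - ip d z y"
  by (simp add: ip_commute[of d z] ip_diff_left)

lemma ip_scaleR_right: "ip d z (c *\<^sub>R x) = c * ip d z x"
  by (simp add: ip_commute[of d z] ip_scaleR_left)

lemmas ip_linear = ip_add_left ip_diff_left ip_scaleR_left ip_sum_left ip_diff_right ip_scaleR_right

lemma ip_self_nonneg [simp]: "0 \<le> ip d x x"
  by (simp add: ip_def sum_nonneg)

lemma ip_self_eq_0_iff: "ip d x x = 0 \<longleftrightarrow> (\<forall>i<d. x i = 0)"
  by (auto simp: ip_def sum_nonneg_eq_0_iff)

lemma ip_self_eq_0D: "ip d x x = 0 \<Longrightarrow> ip d y x = 0"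
  unfolding ip_self_eq_0_iff by (simp add: ip_def)

lemma ip_self_eq_0_Rdim: "x \<in> Rdim d \<Longrightarrow> ip d x x = 0 \<Longrightarrow> x = 0"
  unfolding ip_self_eq_0_iff Rdim_def by (auto simp: fun_eq_iff not_le[symmetric])

lemma subspace_Rdim: "subspace (Rdim d)"
  by (auto simp: subspace_def Rdim_def scaleR_fun_def)

text \<open>Pythagoras for the projection onto an orthogonal system. The left side is nonnegative,
  so this contains Bessel's inequality; a vanishing \<open>z j\<close> contributes 0 on both
  sides.\<close>

lemma ip_residual:
  fixes k :: nat
  assumes "\<And>i j. i < k \<Longrightarrow> j < i \<Longrightarrow> ip d (z i) (z j) = 0"
  shows "ip d (x - (\<Sum>j<k. (ip d x (z j) / ip d (z j) (z j)) *\<^sub>R z j))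
              (x - (\<Sum>j<k. (ip d x (z j) / ip d (z j) (z j)) *\<^sub>R z j))
    = ip d x x - (\<Sum>j<k. (ip d x (z j))\<^sup>2 / ip d (z j) (z j))"
  using assms
proof (induction k)
  case 0
  then show ?case by simp
next
  case (Suc k)
  \<comment> \<open>The residual after \<open>k\<close> vectors. Orthogonality makes its pairing
    with \<open>z k\<close> equal to that of \<open>x\<close>, so only one more square has to be
    expanded.\<close>
  define y where "y = x - (\<Sum>j<k. (ip d x (z j) / ip d (z j) (z j)) *\<^sub>R z j)"
  define c where "c = ip d x (z k) / ip d (z k) (z k)"
  have yz: "ip d y (z k) = ip d x (z k)"
    using Suc.prems by (simp add: y_def ip_linear ip_commute[of d _ "z k"])
  have e1: "x - (\<Sum>j<Suc k. (ip d x (z j) / ip d (z j) (z j)) *\<^sub>R z j) = y - c *\<^sub>R z k"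
    by (simp add: y_def c_def)
  have e2: "ip d (y - c *\<^sub>R z k) (y - c *\<^sub>R z k)
      = ip d y y - 2 * c * ip d x (z k) + c\<^sup>2 * ip d (z k) (z k)"
    by (simp add: ip_linear ip_commute[of d "z k" y] yz power2_eq_square algebra_simps)
  have e3: "- 2 * c * ip d x (z k) + c\<^sup>2 * ip d (z k) (z k)
      = - ((ip d x (z k))\<^sup>2 / ip d (z k) (z k))"
    by (simp add: c_def power2_eq_square field_simps)
  have e4: "ip d y y = ip d x x - (\<Sum>j<k. (ip d x (z j))\<^sup>2 / ip d (z j) (z j))"
    unfolding y_def using Suc.prems by (intro Suc.IH) auto
  have e5: "(\<Sum>j<Suc k. (ip d x (z j))\<^sup>2 / ip d (z j) (z j))
      = (\<Sum>j<k. (ip d x (z j))\<^sup>2 / ip d (z j) (z j)) + (ip d x (z k))\<^sup>2 / ip d (z k) (z k)"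
    by simp
  show ?case
    unfolding e1 e2 e5 using e3 e4 by linarith
qed

text \<open>
  Unnormalised Gram--Schmidt. A vanishing \<open>z\<^sub>j\<close> drops out of the sum because \<open>x / 0 = 0\<close>, so that
  orthogonality and Bessel's inequality hold for dependent points as well.
\<close>

function gs :: "nat \<Rightarrow> (nat \<Rightarrow> nat \<Rightarrow> real) \<Rightarrow> nat \<Rightarrow> nat \<Rightarrow> real" where
  "gs d x k = x k - (\<Sum>j<k. (ip d (x k) (gs d x j) / ip d (gs d x j) (gs d x j)) *\<^sub>R gs d x j)"
  by auto
termination by (relation "Wellfounded.measure (\<lambda>(d, x, k). k)") auto

declare gs.simps [simp del]

text \<open>The common value of \<open>\<langle>z\<^sub>k, y\<rangle>\<close> for all solutions \<open>y\<close> of \<open>\<langle>x\<^sub>j, y\<rangle> = 1\<close>, \<open>j \<le> k\<close>.\<close>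

function gcoord :: "nat \<Rightarrow> (nat \<Rightarrow> nat \<Rightarrow> real) \<Rightarrow> nat \<Rightarrow> real" where
  "gcoord d x k =
     1 - (\<Sum>j<k. ip d (x k) (gs d x j) / ip d (gs d x j) (gs d x j) * gcoord d x j)"
  by auto
termination by (relation "Wellfounded.measure (\<lambda>(d, x, k). k)") auto

declare gcoord.simps [simp del]

text \<open>By orthogonality this is the squared norm of the combination of the
  \<open>gs d x j\<close> with coefficients
  \<open>gcoord d x j / ip d (gs d x j) (gs d x j)\<close>. That vector is the shortest solution of
  the first \<open>k\<close> equations when no residual vanishes.\<close>

definition min_norm2 :: "nat \<Rightarrow> nat \<Rightarrow> (nat \<Rightarrow> nat \<Rightarrow> real) \<Rightarrow> real" where
  "min_norm2 d k x = (\<Sum>j<k. (gcoord d x j)\<^sup>2 / ip d (gs d x j) (gs d x j))"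

text \<open>Locality: changing the point with index \<open>k\<close> leaves all earlier residuals
  alone, so that one point at a time can be integrated out.\<close>

lemma gs_cong: "(\<And>j. j \<le> k \<Longrightarrow> x j = y j) \<Longrightarrow> gs d x k = gs d y k"
proof (induction k rule: less_induct)
  case (less k)
  then have "gs d x j = gs d y j" if "j < k" for j
    using that by auto
  with less.prems show ?case
    by (simp add: gs.simps[of d _ k])
qed

lemma gcoord_cong: "(\<And>j. j \<le> k \<Longrightarrow> x j = y j) \<Longrightarrow> gcoord d x k = gcoord d y k"
proof (induction k rule: less_induct)
  case (less k)
  then have "gcoord d x j = gcoord d y j" "gs d x j = gs d y j" if "j < k" for j
    using that gs_cong[of j x y d] by auto
  with less.prems show ?case
    by (simp add: gcoord.simps[of d _ k])
qed

lemma gs_orthogonal: "j < k \<Longrightarrow> ip d (gs d x k) (gs d x j) = 0"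
proof (induction k arbitrary: j rule: less_induct)
  case (less k)
  have "ip d (gs d x i) (gs d x j) = 0" if "i < k" "i \<noteq> j" for i
    using less.IH[of i j] less.IH[of j i] less.prems that
    by (metis ip_commute nat_neq_iff)
  then have "(\<Sum>i<k. ip d (x k) (gs d x i) / ip d (gs d x i) (gs d x i) * ip d (gs d x i) (gs d x j))
      = (\<Sum>i\<in>{j}. ip d (x k) (gs d x i) / ip d (gs d x i) (gs d x i) * ip d (gs d x i) (gs d x j))"
    using less.prems by (intro sum.mono_neutral_right) auto
  \<comment> \<open>If \<open>gs d x j\<close> vanishes, the quotient is 0 by default and the right
    side is 0 too.\<close>
  also have "\<dots> = ip d (x k) (gs d x j)"
    using ip_self_eq_0D[of d "gs d x j" "x k"] by auto
  finally show ?case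
    by (subst gs.simps) (simp add: ip_linear)
qed

lemma ip_gs: "(\<And>j. j \<le> k \<Longrightarrow> ip d (x j) y = 1) \<Longrightarrow> ip d (gs d x k) y = gcoord d x k"
proof (induction k rule: less_induct)
  case (less k)
  then have "ip d (gs d x j) y = gcoord d x j" if "j < k" for j
    using that by auto
  with less.prems show ?case
    by (subst gs.simps, subst gcoord.simps) (simp add: ip_linear)
qed

text \<open>Bessel's inequality for \<open>y\<close> against the residuals; by \<open>ip_gs\<close>
  the pairings are the numbers \<open>gcoord d x j\<close>, the same for every solution.\<close>

lemma min_norm2_le:
  assumes "\<And>j. j < k \<Longrightarrow> ip d (x j) y = 1"
  shows "min_norm2 d k x \<le> ip d y y"
proof -
  have "ip d y (gs d x j) = gcoord d x j" if "j < k" for j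
    using that assms by (subst ip_commute, intro ip_gs) auto
  then have "min_norm2 d k x = (\<Sum>j<k. (ip d y (gs d x j))\<^sup>2 / ip d (gs d x j) (gs d x j))"
    by (simp add: min_norm2_def)
  also have "0 \<le> ip d y y - \<dots>"
    by (subst ip_residual[of k d "gs d x" y, symmetric]) (auto intro: gs_orthogonal)
  finally show ?thesis by simp
qed

lemma ip_gs_self:
  "ip d (gs d x k) (gs d x k)
     = ip d (x k) (x k) - (\<Sum>j<k. (ip d (x k) (gs d x j))\<^sup>2 / ip d (gs d x j) (gs d x j))"
  by (subst (1 2) gs.simps, rule ip_residual) (rule gs_orthogonal)

lemma diff_diff_self: "a - (a - b) = (b :: 'a :: ab_group_add)"
  by simp

lemma gs_diff_in_span: "x k - gs d x k \<in> span (x ` {..<k})"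
proof (induction k rule: less_induct)
  case (less k)
  have "gs d x j \<in> span (x ` {..<k})" if "j < k" for j
  proof -
    have "x j - gs d x j \<in> span (x ` {..<k})"
      using that by (intro subsetD[OF span_mono less[OF that]]) auto
    moreover have "x j \<in> span (x ` {..<k})"
      using that by (auto intro: span_base)
    ultimately have "x j - (x j - gs d x j) \<in> span (x ` {..<k})"
      by (rule span_diff[rotated])
    then show ?thesis by (simp only: diff_diff_self)
  qed
  then have "(\<Sum>j<k. (ip d (x k) (gs d x j) / ip d (gs d x j) (gs d x j)) *\<^sub>R gs d x j)
      \<in> span (x ` {..<k})"
    by (intro span_sum span_scale) simp
  moreover have "x k - gs d x k
      = (\<Sum>j<k. (ip d (x k) (gs d x j) / ip d (gs d x j) (gs d x j)) *\<^sub>R gs d x j)"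
    by (subst gs.simps) (rule diff_diff_self)
  ultimately show ?case
    by (simp only:)
qed

lemma gs_nonzero:
  assumes indep: "independent (x ` {..<k})" and inj: "inj_on x {..<k}"
    and R: "\<And>j. j < k \<Longrightarrow> x j \<in> Rdim d" and j: "j < k"
  shows "ip d (gs d x j) (gs d x j) \<noteq> 0"
proof
  assume 0: "ip d (gs d x j) (gs d x j) = 0"
  have "span (x ` {..<j}) \<subseteq> Rdim d"
  proof (rule span_minimal[OF _ subspace_Rdim])
    show "x ` {..<j} \<subseteq> Rdim d"
    proof (rule image_subsetI)
      fix i assume "i \<in> {..<j}"
      then have "i < k"
        using j by simp
      then show "x i \<in> Rdim d"
        by (rule R)
    qed
  qed
  \<comment> \<open>\<open>ip d\<close> sees only the first \<open>d\<close> coordinates; membership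
    in \<open>Rdim d\<close> turns zero norm into the zero vector.\<close>
  then have "x j - (x j - gs d x j) \<in> Rdim d"
    by (rule subspace_diff[OF subspace_Rdim R[OF j] subsetD[OF _ gs_diff_in_span]])
  with 0 have "gs d x j = 0"
    by (intro ip_self_eq_0_Rdim) (simp_all only: diff_diff_self)
  then have "x j \<in> span (x ` {..<j})"
    using gs_diff_in_span[of x j d] by (simp only: diff_zero)
  \<comment> \<open>By injectivity no predecessor equals \<open>x j\<close>.\<close>
  also have "\<dots> \<subseteq> span (x ` {..<k} - {x j})"
    using inj j by (intro span_mono) (auto simp: inj_on_def)
  finally show False
    using indep j unfolding dependent_def by blast
qed

section \<open>From facets to index sets of vertices\<close>

text \<open>The points lie on a hyperplane that misses the origin. Pairing a linear relation with
  \<open>y\<close> shows that its coefficients sum to 1, so it is an affine relation.\<close>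

lemma affine_independent_imp_independent:
  assumes "finite B" and y: "\<And>b. b \<in> B \<Longrightarrow> ip d b y = 1" and B: "\<not> affine_dependent B"
  shows "independent B"
proof
  assume "dependent B"
  then obtain b where b: "b \<in> B" "b \<in> span (B - {b})"
    by (auto simp: dependent_def)
  then obtain c where c: "b = (\<Sum>v\<in>B - {b}. c v *\<^sub>R v)"
    using span_finite[of "B - {b}"] \<open>finite B\<close> by auto
  have "1 = ip d (\<Sum>v\<in>B - {b}. c v *\<^sub>R v) y"
    using b y c by simp
  also have "\<dots> = sum c (B - {b})"
    using y by (simp add: ip_linear)
  finally have "b \<in> affine hull (B - {b})"
    using \<open>finite B\<close> c by (auto simp: affine_hull_finite intro!: exI[of _ c])
  with b B show False
    by (auto simp: affine_dependent_def)
qed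

lemma span_affine_hull: "span (affine hull S) = span S"
proof
  show "span (affine hull S) \<subseteq> span S"
    using affine_hull_subset_span[of S] by (intro span_minimal) auto
  show "span S \<subseteq> span (affine hull S)"
    by (intro span_mono hull_subset)
qed

text \<open>The weighted slacks \<open>h - ip d v u\<close> are nonnegative and sum to 0, so every
  point of positive weight lies on the hyperplane.\<close>

lemma convex_hull_Int_hyperplane:
  assumes fin: "finite V" and le: "\<And>v. v \<in> V \<Longrightarrow> ip d v u \<le> h"
    and t: "t \<in> convex hull V" "ip d t u = h"
  shows "t \<in> span (V \<inter> {x. ip d x u = h})"
proof -
  obtain c where c: "\<And>v. v \<in> V \<Longrightarrow> 0 \<le> c v" "sum c V = 1" "t = (\<Sum>v\<in>V. c v *\<^sub>R v)"
    using t(1) fin by (auto simp: convex_hull_finite)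
  have "(\<Sum>v\<in>V. c v * (h - ip d v u)) = sum c V * h - ip d t u"
    by (simp add: c(3) ip_linear right_diff_distrib sum_subtractf sum_distrib_right)
  then have 0: "(\<Sum>v\<in>V. c v * (h - ip d v u)) = 0"
    using t c by simp
  have "c v * (h - ip d v u) = 0" if "v \<in> V" for v
    using that 0 c(1) le by (subst (asm) sum_nonneg_eq_0_iff) (auto intro!: mult_nonneg_nonneg fin)
  then have "c v *\<^sub>R v \<in> span (V \<inter> {x. ip d x u = h})" if "v \<in> V" for v
    using that by (cases "c v = 0") (auto intro: span_scale span_base span_zero)
  then show ?thesis
    unfolding c(3) by (rule span_sum)
qed

text \<open>The hyperplane of the facet misses the origin, so affine dimension \<open>d - 1\<close>
  becomes linear dimension \<open>d\<close>. A basis of the span can then be chosen among the sample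
  points on the hyperplane.\<close>

lemma facet_points:
  fixes n :: nat
  assumes facet: "facet_with_height d (convex hull (X ` {..<n})) h T" and h: "h \<noteq> 0"
  obtains I u where "I \<subseteq> {..<n}" "card I = d" "inj_on X I" "independent (X ` I)"
    "T \<subseteq> span (X ` I)" "u \<in> usphere d" "T = convex hull (X ` {..<n}) \<inter> {x. ip d x u = h}"
    "\<And>i. i \<in> I \<Longrightarrow> ip d (X i) u = h"
proof -
  let ?P = "convex hull (X ` {..<n})"
  obtain u where u: "u \<in> usphere d" "T = ?P \<inter> {x. ip d x u = h}" "?P \<subseteq> {x. ip d x u \<le> h}"
    using facet by (auto simp: facet_with_height_def)
  obtain B where B: "finite B" "affine hull B = affine hull T" "\<not> affine_dependent B"
    "int (card B) = (int d - 1) + 1"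
    using facet by (auto simp: facet_with_height_def has_aff_dim_def)
  define V where "V = X ` {..<n} \<inter> {x. ip d x u = h}"
  have TV: "T \<subseteq> span V"
  proof
    fix t assume "t \<in> T"
    then show "t \<in> span V"
      unfolding V_def using u hull_subset[of "X ` {..<n}" convex]
      by (intro convex_hull_Int_hyperplane[of _ d u]) auto
  qed
  have VT: "V \<subseteq> T"
    using hull_subset[of "X ` {..<n}" convex] by (auto simp: u(2) V_def)
  have span_eq: "span T = span V"
    by (intro equalityI span_minimal subspace_span TV) (use VT span_superset in blast)
  have aff: "affine {x. ip d x u = h}"
    by (auto simp: affine_def ip_linear) (simp flip: distrib_right)
  have "affine hull T \<subseteq> {x. ip d x u = h}"
    by (rule hull_minimal[of _ _ affine, OF _ aff]) (auto simp: u(2))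
  then have BH: "ip d b u = h" if "b \<in> B" for b
    using B(2) hull_subset[of B affine] that by auto
  have "independent B"
  proof (rule affine_independent_imp_independent[OF B(1) _ B(3)])
    show "ip d b (u /\<^sub>R h) = 1" if "b \<in> B" for b
      using BH[OF that] h by (simp add: ip_linear)
  qed
  \<comment> \<open>The affine basis \<open>B\<close> of \<open>T\<close> is linearly independent,
    has \<open>d\<close> elements and has the same linear span as \<open>T\<close>.\<close>
  then have dimT: "dim (span T) = d"
    using B dim_span_eq_card_independent[of B] span_affine_hull[of B] span_affine_hull[of T] by simp
  obtain B' where B': "B' \<subseteq> V" "independent B'" "V \<subseteq> span B'"
    using maximal_independent_subset by blast
  have "B' \<subseteq> X ` {..<n}"
    using B' by (auto simp: V_def)
  \<comment> \<open>One index is kept for each basis vector, which makes \<open>X\<close> injective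
    on \<open>I\<close> even if sample points coincide.\<close>
  then obtain I where I: "I \<subseteq> {..<n}" "inj_on X I" "B' = X ` I"
    by (auto simp: subset_image_inj)
  have spanB': "span B' = span V"
    by (intro equalityI span_minimal subspace_span B') (use B' span_superset in blast)
  then have "card B' = d"
    using B' dimT span_eq dim_span_eq_card_independent[of B'] by simp
  show thesis
  proof (rule that[of I u])
    show "card I = d"
      using \<open>card B' = d\<close> I by (simp add: card_image)
    show "T \<subseteq> span (X ` I)"
      using TV spanB' I by simp
    show "ip d (X i) u = h" if "i \<in> I" for i
      using that B' I by (auto simp: V_def)
  qed (use I B' u in auto)
qed

text \<open>Here \<open>y\<close> stands for the normal divided by the height, and \<open>s\<close>
  for a bound on \<open>1 / h\<^sup>2\<close>. Injectivity is demanded separately because the image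
  set forgets repeated points.\<close>

definition high_flat :: "nat \<Rightarrow> real \<Rightarrow> (nat \<Rightarrow> nat \<Rightarrow> real) \<Rightarrow> nat set \<Rightarrow> bool" where
  "high_flat d s X I \<longleftrightarrow> inj_on X I \<and> independent (X ` I) \<and>
     (\<exists>y. (\<forall>i\<in>I. ip d (X i) y = 1) \<and> ip d y y \<le> s)"

lemma ip_eq_on_span:
  assumes "x \<in> span S" "\<And>v. v \<in> S \<Longrightarrow> ip d v y = ip d v y'"
  shows "ip d x y = ip d x y'"
proof -
  have "span S \<subseteq> {x. ip d x y = ip d x y'}"
    by (rule span_minimal) (use assms(2) in \<open>auto simp: subspace_def ip_linear\<close>)
  with assms(1) show ?thesis by auto
qed

text \<open>Each facet is sent to the index set from \<open>facet_points\<close>. This map is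
  injective because the facet lies in the span of the chosen points, where their equations determine
  the functional.\<close>

lemma card_facets_le:
  fixes n :: nat
  assumes H: "\<And>h. h \<in> H \<Longrightarrow> h \<noteq> 0 \<and> 1 / h\<^sup>2 \<le> s"
  shows "card {T. \<exists>h\<in>H. facet_with_height d (convex hull (X ` {..<n})) h T}
    \<le> card {I. I \<subseteq> {..<n} \<and> card I = d \<and> high_flat d s X I}"
proof -
  let ?P = "convex hull (X ` {..<n})"
  let ?F = "{T. \<exists>h\<in>H. facet_with_height d ?P h T}"
  define Q where "Q T I \<longleftrightarrow> I \<subseteq> {..<n} \<and> card I = d \<and> high_flat d s X I \<and> T \<subseteq> span (X ` I) \<and>
      (\<exists>y. (\<forall>i\<in>I. ip d (X i) y = 1) \<and> T = ?P \<inter> {x. ip d x y = 1})" for T I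
  have "\<exists>I. Q T I" if "T \<in> ?F" for T
  proof -
    from that obtain h where h: "h \<in> H" "facet_with_height d ?P h T"
      unfolding mem_Collect_eq by blast
    obtain I u where I: "I \<subseteq> {..<n}" "card I = d" "inj_on X I" "independent (X ` I)"
      "T \<subseteq> span (X ` I)" "u \<in> usphere d" "T = ?P \<inter> {x. ip d x u = h}"
      "\<And>i. i \<in> I \<Longrightarrow> ip d (X i) u = h"
      using facet_points[OF h(2)] H[OF h(1)] by metis
    have "ip d (u /\<^sub>R h) (u /\<^sub>R h) = 1 / h\<^sup>2"
      using I(6) by (simp add: ip_linear usphere_def power2_eq_square field_simps)
    then have "ip d (u /\<^sub>R h) (u /\<^sub>R h) \<le> s"
      using H[OF h(1)] by simp
    moreover have "\<forall>i\<in>I. ip d (X i) (u /\<^sub>R h) = 1"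
      using I(8) H[OF h(1)] by (simp add: ip_linear)
    moreover have "T = ?P \<inter> {x. ip d x (u /\<^sub>R h) = 1}"
      unfolding I(7) using H[OF h(1)] by (auto simp: ip_linear field_simps)
    ultimately have "Q T I"
      using I(1-5) unfolding Q_def high_flat_def by blast
    then show ?thesis ..
  qed
  then obtain f where f: "\<And>T. T \<in> ?F \<Longrightarrow> Q T (f T)"
    by metis
  \<comment> \<open>Both normals take the value 1 at the points indexed by \<open>I\<close>, hence
    they agree on the span, which contains \<open>T\<close>.\<close>
  have sub: "T \<subseteq> T'" if QQ: "Q T I" "Q T' I" for T T' I
  proof
    fix t assume t: "t \<in> T"
    obtain y y' where y: "\<forall>i\<in>I. ip d (X i) y = 1" "T = ?P \<inter> {x. ip d x y = 1}"
      "\<forall>i\<in>I. ip d (X i) y' = 1" "T' = ?P \<inter> {x. ip d x y' = 1}"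
      using QQ unfolding Q_def by blast
    have "ip d t y = ip d t y'"
      by (rule ip_eq_on_span[of t "X ` I"]) (use t QQ y in \<open>auto simp: Q_def\<close>)
    with t y show "t \<in> T'" by auto
  qed
  have "inj_on f ?F"
    using sub f by (intro inj_onI) (metis subset_antisym)
  moreover have "f ` ?F \<subseteq> {I. I \<subseteq> {..<n} \<and> card I = d \<and> high_flat d s X I}"
    using f unfolding Q_def by blast
  ultimately show ?thesis
    by (rule card_inj_on_le) (auto intro: finite_subset[of _ "Pow {..<n}"])
qed

subsection \<open>Symmetries of the uniform distribution on the sphere\<close>

lemma borel_measurable_ip2 [measurable (raw)]:
  assumes [measurable]: "f \<in> N \<rightarrow>\<^sub>M borel" "g \<in> N \<rightarrow>\<^sub>M borel"
  shows "(\<lambda>w. ip d (f w) (g w)) \<in> borel_measurable N"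
proof -
  have [measurable]: "(\<lambda>w. f w i) \<in> borel_measurable N" "(\<lambda>w. g w i) \<in> borel_measurable N" for i
    using assms by (auto intro: measurable_product_then_coordinatewise)
  show ?thesis
    unfolding ip_def by measurable
qed

section \<open>Measurability of the Gram--Schmidt quantities\<close>

lemma measurable_gs:
  assumes "\<And>j. j \<le> k \<Longrightarrow> (\<lambda>w. x w j) \<in> N \<rightarrow>\<^sub>M borel"
  shows "(\<lambda>w. gs d (x w) k) \<in> N \<rightarrow>\<^sub>M borel"
  using assms
proof (induction k rule: less_induct)
  case (less k)
  have [measurable]: "(\<lambda>w. x w k) \<in> N \<rightarrow>\<^sub>M borel"
    using less.prems by simp
  have m [measurable]: "(\<lambda>w. gs d (x w) j) \<in> N \<rightarrow>\<^sub>M borel" if "j < k" for j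
    using that less by auto
  have [measurable]: "(\<lambda>w. ip d (x w k) (gs d (x w) j)) \<in> borel_measurable N"
    "(\<lambda>w. ip d (gs d (x w) j) (gs d (x w) j)) \<in> borel_measurable N" if "j < k" for j
    using m[OF that] by measurable
  have sum_apply: "(\<Sum>j\<in>J. c j *\<^sub>R z j) i = (\<Sum>j\<in>J. c j * z j i)" for J and c :: "nat \<Rightarrow> real" and z i
    by (induction J rule: infinite_finite_induct) (auto simp: scaleR_fun_def)
  show ?case
  proof (rule measurable_coordinatewise_then_product)
    fix i
    have [measurable]: "(\<lambda>w. gs d (x w) j i) \<in> borel_measurable N" if "j < k" for j
      using m[OF that] by (rule measurable_product_then_coordinatewise)
    have [measurable]: "(\<lambda>w. x w k i) \<in> borel_measurable N"
      using less.prems by (intro measurable_product_then_coordinatewise[of "\<lambda>w. x w k"]) simp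
    show "(\<lambda>w. gs d (x w) k i) \<in> borel_measurable N"
      by (subst gs.simps) (simp add: sum_apply fun_diff_def del: sum.lessThan_Suc)
  qed
qed

lemma measurable_gcoord:
  assumes "\<And>j. j \<le> k \<Longrightarrow> (\<lambda>w. x w j) \<in> N \<rightarrow>\<^sub>M borel"
  shows "(\<lambda>w. gcoord d (x w) k) \<in> borel_measurable N"
  using assms
proof (induction k rule: less_induct)
  case (less k)
  have x [measurable]: "(\<lambda>w. x w k) \<in> N \<rightarrow>\<^sub>M borel"
    using less.prems by simp
  have m [measurable]: "(\<lambda>w. gs d (x w) j) \<in> N \<rightarrow>\<^sub>M borel" if "j < k" for j
    using that less.prems by (intro measurable_gs) auto
  have [measurable]: "(\<lambda>w. gcoord d (x w) j) \<in> borel_measurable N" if "j < k" for j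
    using that less by auto
  show ?case
    by (subst gcoord.simps) (use m x in measurable)
qed

text \<open>
  The value \<open>0\<close> for dependent points spares a proof that the random points are almost surely
  independent: the mean of \<open>\<bar>z\<^sub>k\<bar>\<^sup>2\<close> is \<open>(d - k) / d\<close> only if all the previous \<open>z\<^sub>j\<close> are non-zero.
\<close>

definition indep_exp :: "nat \<Rightarrow> real \<Rightarrow> nat \<Rightarrow> (nat \<Rightarrow> nat \<Rightarrow> real) \<Rightarrow> real" where
  "indep_exp d \<mu> k x = (if \<forall>j<k. ip d (gs d x j) (gs d x j) \<noteq> 0 then exp (- \<mu> * min_norm2 d k x) else 0)"

lemma measurable_indep_exp:
  assumes "\<And>j. j < k \<Longrightarrow> (\<lambda>w. x w j) \<in> N \<rightarrow>\<^sub>M borel"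
  shows "(\<lambda>w. indep_exp d \<mu> k (x w)) \<in> borel_measurable N"
proof -
  have [measurable]: "(\<lambda>w. ip d (gs d (x w) j) (gs d (x w) j)) \<in> borel_measurable N" if "j < k" for j
    using that assms by (intro borel_measurable_ip2 measurable_gs) auto
  have [measurable]: "(\<lambda>w. gcoord d (x w) j) \<in> borel_measurable N" if "j < k" for j
    using that assms by (intro measurable_gcoord) auto
  have "(\<lambda>w. min_norm2 d k (x w)) \<in> borel_measurable N"
    unfolding min_norm2_def by measurable
  moreover have "(\<lambda>w. \<forall>j\<in>{..<k}. ip d (gs d (x w) j) (gs d (x w) j) \<noteq> 0) \<in> measurable N (count_space UNIV)"
    by measurable
  ultimately show ?thesis
    unfolding indep_exp_def by (auto simp: Ball_def intro!: measurable_If)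
qed

section \<open>Invariance under signed coordinate permutations\<close>

text \<open>These orthogonal maps suffice in place of all rotations: they determine the second
  moments of the coordinates and include \<open>x \<mapsto> - x\<close>.\<close>

definition signed_perm :: "(nat \<Rightarrow> real) \<Rightarrow> (nat \<Rightarrow> nat) \<Rightarrow> (nat \<Rightarrow> real) \<Rightarrow> nat \<Rightarrow> real" where
  "signed_perm s p x = (\<lambda>i. s i * x (p i))"

lemma measurable_signed_perm [measurable]: "signed_perm s p \<in> borel \<rightarrow>\<^sub>M borel"
  by (rule measurable_coordinatewise_then_product) (simp add: signed_perm_def)

lemma emeasure_lborel_sign:
  assumes "s \<in> {-1, 1 :: real}" "A \<in> sets borel"
  shows "emeasure lborel {t. s * t \<in> A} = emeasure lborel A"
proof (cases "s = 1")
  case False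
  then have "{t. s * t \<in> A} = uminus -` A \<inter> space lborel"
    using assms by auto
  also have "emeasure lborel \<dots> = emeasure (distr lborel borel uminus) A"
    using assms by (subst emeasure_distr) auto
  finally show ?thesis
    by (simp add: lborel_distr_uminus)
qed simp

lemma measurable_PiM_signed_perm:
  fixes s :: "nat \<Rightarrow> real" and d :: nat
  assumes p: "p permutes {..<d}"
  shows "(\<lambda>x. \<lambda>i\<in>{..<d}. s i * x (p i)) \<in> Pi\<^sub>M {..<d} (\<lambda>_. lborel :: real measure) \<rightarrow>\<^sub>M Pi\<^sub>M {..<d} (\<lambda>_. lborel)"
proof (rule measurable_restrict)
  fix i assume "i \<in> {..<d}"
  then have "(\<lambda>x. x (p i)) \<in> Pi\<^sub>M {..<d} (\<lambda>_. lborel :: real measure) \<rightarrow>\<^sub>M lborel"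
    using permutes_in_image[OF p] by (intro measurable_component_singleton) simp
  then have "(\<lambda>x. x (p i)) \<in> borel_measurable (Pi\<^sub>M {..<d} (\<lambda>_. lborel :: real measure))"
    by simp
  then show "(\<lambda>x. s i * x (p i)) \<in> Pi\<^sub>M {..<d} (\<lambda>_. lborel) \<rightarrow>\<^sub>M (lborel :: real measure)"
    by simp
qed

text \<open>It is enough to compare boxes. The preimage of a box is a box with permuted and possibly
  reflected sides, and the product of the side measures is unchanged.\<close>

lemma distr_PiM_signed_perm:
  fixes s :: "nat \<Rightarrow> real" and d :: nat
  assumes p: "p permutes {..<d}" and s: "\<And>i. s i \<in> {-1, 1 :: real}"
  defines "L \<equiv> Pi\<^sub>M {..<d} (\<lambda>_. lborel :: real measure)"
  shows "distr L L (\<lambda>x. \<lambda>i\<in>{..<d}. s i * x (p i)) = L"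
proof -
  interpret product_sigma_finite "\<lambda>_::nat. lborel :: real measure" ..
  have pi: "p i < d" if "i < d" for i
    using permutes_in_image[OF p] that by simp
  have meas: "(\<lambda>x. \<lambda>i\<in>{..<d}. s i * x (p i)) \<in> L \<rightarrow>\<^sub>M L"
    unfolding L_def by (rule measurable_PiM_signed_perm[OF p])
  show ?thesis
    unfolding L_def
  proof (rule PiM_eqI)
    fix A assume A: "\<And>i. i \<in> {..<d} \<Longrightarrow> A i \<in> sets (lborel :: real measure)"
    let ?q = "inv p"
    have q: "p (?q j) = j" "?q (p j) = j" for j
      using permutes_inverses[OF p] by auto
    have qi: "?q j < d" if "j < d" for j
      using permutes_in_image[OF permutes_inv[OF p]] that by simp
    have B: "{t. s (?q j) * t \<in> A (?q j)} \<in> sets borel" if "j < d" for j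
    proof -
      have [measurable]: "A (?q j) \<in> sets borel"
        using A[of "?q j"] qi[OF that] by simp
      show ?thesis by measurable
    qed
    \<comment> \<open>Coordinate \<open>j\<close> of the argument appears at position
      \<open>inv p j\<close> of the image, so it is constrained by the side with that index.\<close>
    have pre: "(\<lambda>x. \<lambda>i\<in>{..<d}. s i * x (p i)) -` Pi\<^sub>E {..<d} A \<inter> space (Pi\<^sub>M {..<d} (\<lambda>_. lborel))
      = Pi\<^sub>E {..<d} (\<lambda>j. {t. s (?q j) * t \<in> A (?q j)})"
    proof (intro equalityI subsetI)
      fix x assume x: "x \<in> (\<lambda>x. \<lambda>i\<in>{..<d}. s i * x (p i)) -` Pi\<^sub>E {..<d} A \<inter> space (Pi\<^sub>M {..<d} (\<lambda>_. lborel))"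
      then have "s i * x (p i) \<in> A i" if "i < d" for i
        using that by (auto simp: PiE_iff)
      from this[OF qi] x show "x \<in> Pi\<^sub>E {..<d} (\<lambda>j. {t. s (?q j) * t \<in> A (?q j)})"
        by (auto simp: PiE_iff space_PiM q)
    next
      fix x assume x: "x \<in> Pi\<^sub>E {..<d} (\<lambda>j. {t. s (?q j) * t \<in> A (?q j)})"
      then have "s (?q j) * x j \<in> A (?q j)" if "j < d" for j
        using that by (auto simp: PiE_iff)
      from this[OF pi] x show "x \<in> (\<lambda>x. \<lambda>i\<in>{..<d}. s i * x (p i)) -` Pi\<^sub>E {..<d} A \<inter> space (Pi\<^sub>M {..<d} (\<lambda>_. lborel))"
        by (auto simp: PiE_iff space_PiM q)
    qed
    have "emeasure (distr (Pi\<^sub>M {..<d} (\<lambda>_. lborel)) (Pi\<^sub>M {..<d} (\<lambda>_. lborel)) (\<lambda>x. \<lambda>i\<in>{..<d}. s i * x (p i))) (Pi\<^sub>E {..<d} A)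
      = emeasure (Pi\<^sub>M {..<d} (\<lambda>_. lborel)) (Pi\<^sub>E {..<d} (\<lambda>j. {t. s (?q j) * t \<in> A (?q j)}))"
      using meas[unfolded L_def] A
      by (subst emeasure_distr) (auto simp: pre intro!: sets_PiM_I_finite)
    also have "\<dots> = (\<Prod>j<d. emeasure lborel {t. s (?q j) * t \<in> A (?q j)})"
      using B by (intro emeasure_PiM) auto
    also have "\<dots> = (\<Prod>j<d. emeasure lborel (A (?q j)))"
      using A qi by (intro prod.cong emeasure_lborel_sign s) auto
    also have "\<dots> = (\<Prod>j<d. emeasure lborel (A j))"
      using prod.permute[OF permutes_inv[OF p], of "\<lambda>j. emeasure lborel (A j)"] by (simp add: o_def)
    finally show "emeasure (distr (Pi\<^sub>M {..<d} (\<lambda>_. lborel)) (Pi\<^sub>M {..<d} (\<lambda>_. lborel)) (\<lambda>x. \<lambda>i\<in>{..<d}. s i * x (p i))) (Pi\<^sub>E {..<d} A)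
      = (\<Prod>j<d. emeasure lborel (A j))" .
  qed auto
qed

text \<open>Extension by zeros commutes with the signed permutation because \<open>p\<close> fixes
  every index from \<open>d\<close> on.\<close>

lemma distr_lebesgue_Rdim_signed_perm:
  assumes p: "p permutes {..<d}" and s: "\<And>i. s i \<in> {-1, 1}"
  shows "distr (lebesgue_Rdim d) borel (signed_perm s p) = lebesgue_Rdim d"
proof -
  let ?L = "Pi\<^sub>M {..<d} (\<lambda>_. lborel :: real measure)"
  let ?E = "\<lambda>x i. if i < d then x i else 0 :: real"
  let ?f = "\<lambda>x. \<lambda>i\<in>{..<d}. s i * x (p i)"
  have pi: "p i < d" if "i < d" for i
    using permutes_in_image[OF p] that by simp
  have pn: "p i = i" if "\<not> i < d" for i
    using permutes_not_in[OF p] that by simp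
  have meas: "?f \<in> ?L \<rightarrow>\<^sub>M ?L"
    by (rule measurable_PiM_signed_perm[OF p])
  have "distr (lebesgue_Rdim d) borel (signed_perm s p) = distr ?L borel (signed_perm s p \<circ> ?E)"
    unfolding lebesgue_Rdim_def by (rule distr_distr) measurable
  also have "signed_perm s p \<circ> ?E = ?E \<circ> ?f"
    using pi pn by (auto simp: fun_eq_iff signed_perm_def)
  also have "distr ?L borel (?E \<circ> ?f) = distr (distr ?L ?L ?f) borel ?E"
    by (rule distr_distr[symmetric, OF measurable_extend0 meas])
  also have "\<dots> = lebesgue_Rdim d"
    unfolding distr_PiM_signed_perm[OF p s] lebesgue_Rdim_def ..
  finally show ?thesis .
qed

lemma ip_signed_perm:
  assumes p: "p permutes {..<d}" and s: "\<And>i. s i \<in> {-1, 1}"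
  shows "ip d (signed_perm s p x) (signed_perm s p x) = ip d x x"
proof -
  have "s i * s i = 1" for i
    using s[of i] by auto
  then have "ip d (signed_perm s p x) (signed_perm s p x) = (\<Sum>i<d. x (p i) * x (p i))"
    unfolding ip_def signed_perm_def by (intro sum.cong refl) (metis mult.assoc mult.left_commute mult_1)
  also have "\<dots> = ip d x x"
    unfolding ip_def using sum.permute[OF p, of "\<lambda>i. x i * x i"] by (simp add: o_def)
  finally show ?thesis .
qed

lemma signed_perm_in_uball:
  assumes p: "p permutes {..<d}" and s: "\<And>i. s i \<in> {-1, 1}"
  shows "signed_perm s p x \<in> uball d \<longleftrightarrow> x \<in> uball d"
proof -
  have "s i \<noteq> 0" for i
    using s[of i] by auto
  moreover have "p i = i" if "i \<ge> d" for i
    using permutes_not_in[OF p] that by simp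
  ultimately have "signed_perm s p x \<in> Rdim d \<longleftrightarrow> x \<in> Rdim d"
    by (auto simp: Rdim_def signed_perm_def)
  then show ?thesis
    by (simp add: uball_def ip_signed_perm[OF assms])
qed

text \<open>Lebesgue measure and the ball are invariant, and radial normalisation commutes with a
  map that preserves the norm.\<close>

lemma distr_uniform_usphere_signed_perm:
  assumes p: "p permutes {..<d}" and s: "\<And>i. s i \<in> {-1, 1}"
  shows "distr (uniform_usphere d) borel (signed_perm s p) = uniform_usphere d"
proof -
  let ?U = "uniform_measure (lebesgue_Rdim d) (uball d)"
  let ?N = "\<lambda>x. x /\<^sub>R sqrt (ip d x x)"
  let ?f = "signed_perm s p"
  have U: "distr ?U borel ?f = ?U"
  proof (rule measure_eqI)
    fix A assume "A \<in> sets (distr ?U borel ?f)"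
    then have A [measurable]: "A \<in> sets borel"
      by simp
    have "emeasure (distr ?U borel ?f) A = emeasure ?U (?f -` A)"
      by (subst emeasure_distr) (auto simp: lebesgue_Rdim_def)
    also have "\<dots> = emeasure (lebesgue_Rdim d) (uball d \<inter> ?f -` A) / emeasure (lebesgue_Rdim d) (uball d)"
      using measurable_sets[OF measurable_signed_perm A, of s p] by (intro emeasure_uniform_measure) auto
    also have "uball d \<inter> ?f -` A = ?f -` (uball d \<inter> A) \<inter> space (lebesgue_Rdim d)"
      by (auto simp: signed_perm_in_uball[OF assms] lebesgue_Rdim_def)
    also have "emeasure (lebesgue_Rdim d) \<dots> = emeasure (distr (lebesgue_Rdim d) borel ?f) (uball d \<inter> A)"
      by (rule emeasure_distr[symmetric]) auto
    also have "\<dots> = emeasure (lebesgue_Rdim d) (uball d \<inter> A)"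
      by (simp add: distr_lebesgue_Rdim_signed_perm[OF assms])
    also have "\<dots> / emeasure (lebesgue_Rdim d) (uball d) = emeasure ?U A"
      by (rule emeasure_uniform_measure[symmetric]) auto
    finally show "emeasure (distr ?U borel ?f) A = emeasure ?U A" .
  qed simp
  have "distr (uniform_usphere d) borel ?f = distr ?U borel (?f \<circ> ?N)"
    unfolding uniform_usphere_def by (rule distr_distr) measurable
  also have "?f \<circ> ?N = ?N \<circ> ?f"
    by (simp add: fun_eq_iff ip_signed_perm[OF assms]) (simp add: signed_perm_def scaleR_fun_def)
  also have "distr ?U borel (?N \<circ> ?f) = distr (distr ?U borel ?f) borel ?N"
    by (rule distr_distr[symmetric]) measurable
  also have "\<dots> = uniform_usphere d"
    unfolding U uniform_usphere_def ..
  finally show ?thesis .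
qed

lemma sets_uniform_usphere [simp, measurable_cong]: "sets (uniform_usphere d) = sets borel"
  by (simp add: uniform_usphere_def)

lemma space_uniform_usphere [simp]: "space (uniform_usphere d) = UNIV"
  by (simp add: uniform_usphere_def)

lemma integral_signed_perm:
  fixes g :: "(nat \<Rightarrow> real) \<Rightarrow> real"
  assumes "p permutes {..<d}" "\<And>i. s i \<in> {-1, 1}" and [measurable]: "g \<in> borel_measurable borel"
  shows "(\<integral>x. g (signed_perm s p x) \<partial>uniform_usphere d) = (\<integral>x. g x \<partial>uniform_usphere d)"
proof -
  have "(\<integral>x. g x \<partial>uniform_usphere d) = (\<integral>x. g x \<partial>distr (uniform_usphere d) borel (signed_perm s p))"
    by (simp only: distr_uniform_usphere_signed_perm[OF assms(1,2)])
  also have "\<dots> = (\<integral>x. g (signed_perm s p x) \<partial>uniform_usphere d)"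
    by (rule integral_distr) measurable
  finally show ?thesis ..
qed

section \<open>Second moments on the sphere\<close>

lemma usphere_coord_le_1:
  assumes "x \<in> usphere d"
  shows "\<bar>x i\<bar> \<le> 1"
proof (cases "i < d")
  case True
  then have "x i * x i \<le> (\<Sum>i<d. x i * x i)"
    by (intro member_le_sum) auto
  then have "(x i)\<^sup>2 \<le> 1"
    using assms by (simp add: usphere_def ip_def power2_eq_square)
  then show ?thesis
    by (simp add: abs_square_le_1)
next
  case False
  then show ?thesis
    using assms by (auto simp: usphere_def Rdim_def)
qed

lemma integrable_coord_mult:
  assumes "0 < d"
  shows "integrable (uniform_usphere d) (\<lambda>x. x i * x j)"
proof -
  interpret prob_space "uniform_usphere d"
    by (rule prob_space_uniform_usphere[OF assms])
  show ?thesis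
  proof (rule integrable_const_bound[where B = 1])
    show "AE x in uniform_usphere d. norm (x i * x j) \<le> 1"
      using AE_uniform_usphere[OF assms]
      by eventually_elim (auto simp: abs_mult intro!: mult_le_one usphere_coord_le_1)
  qed measurable
qed

text \<open>Flipping the sign of coordinate \<open>i\<close> alone preserves the distribution and
  negates the integrand.\<close>

lemma integral_coord_mult_distinct:
  assumes "i \<noteq> j"
  shows "(\<integral>x. x i * x j \<partial>uniform_usphere d) = 0"
proof -
  define s where "s = (\<lambda>k. if k = i then - 1 else 1 :: real)"
  have "(\<integral>x. x i * x j \<partial>uniform_usphere d)
      = (\<integral>x. signed_perm s id x i * signed_perm s id x j \<partial>uniform_usphere d)"
    by (rule integral_signed_perm[symmetric]) (auto simp: s_def permutes_id)
  also have "\<dots> = - (\<integral>x. x i * x j \<partial>uniform_usphere d)"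
    using assms by (simp add: signed_perm_def s_def)
  finally show ?thesis by simp
qed

text \<open>Transpositions make the \<open>d\<close> second moments equal, and they sum to 1 on the
  sphere.\<close>

lemma integral_coord_square:
  assumes "i < d"
  shows "(\<integral>x. x i * x i \<partial>uniform_usphere d) = 1 / real d"
proof -
  interpret prob_space "uniform_usphere d"
    using assms by (intro prob_space_uniform_usphere) auto
  have eq: "(\<integral>x. x i * x i \<partial>uniform_usphere d) = (\<integral>x. x j * x j \<partial>uniform_usphere d)" if "j < d" for j
  proof -
    have "(\<integral>x. x i * x i \<partial>uniform_usphere d)
      = (\<integral>x. signed_perm (\<lambda>_. 1) (Transposition.transpose i j) x i * signed_perm (\<lambda>_. 1) (Transposition.transpose i j) x i \<partial>uniform_usphere d)"
      using assms that by (intro integral_signed_perm[symmetric] permutes_swap_id) auto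
    then show ?thesis
      by (simp add: signed_perm_def)
  qed
  have "1 = (\<integral>x. (1::real) \<partial>uniform_usphere d)"
    using prob_space by simp
  also have "\<dots> = (\<integral>x. (\<Sum>j<d. x j * x j) \<partial>uniform_usphere d)"
  proof (rule integral_cong_AE)
    show "AE x in uniform_usphere d. 1 = (\<Sum>j<d. x j * x j)"
      using AE_uniform_usphere[of d] assms by (auto simp: usphere_def ip_def elim!: AE_mp)
  qed measurable
  also have "\<dots> = (\<Sum>j<d. \<integral>x. x j * x j \<partial>uniform_usphere d)"
    using assms by (intro Bochner_Integration.integral_sum integrable_coord_mult) auto
  also have "\<dots> = (\<Sum>j<d. \<integral>x. x i * x i \<partial>uniform_usphere d)"
    using eq by (intro sum.cong) auto
  finally show ?thesis
    using assms by (simp add: field_simps)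
qed

text \<open>Isotropy: by the two moment identities above, the second-moment matrix is the identity
  divided by \<open>d\<close>.\<close>

lemma
  assumes "0 < d"
  shows integrable_ip_square: "integrable (uniform_usphere d) (\<lambda>x. (ip d x v)\<^sup>2)"
    and integral_ip_square: "(\<integral>x. (ip d x v)\<^sup>2 \<partial>uniform_usphere d) = ip d v v / real d"
proof -
  have eq: "(\<lambda>x. (ip d x v)\<^sup>2) = (\<lambda>x. \<Sum>i<d. \<Sum>j<d. (v i * v j) * (x i * x j))"
    by (simp add: fun_eq_iff ip_def power2_eq_square sum_product mult_ac)
  show "integrable (uniform_usphere d) (\<lambda>x. (ip d x v)\<^sup>2)"
    unfolding eq using assms by (intro Bochner_Integration.integrable_sum integrable_mult_right integrable_coord_mult)
  have "(\<integral>x. (ip d x v)\<^sup>2 \<partial>uniform_usphere d)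
      = (\<Sum>i<d. \<Sum>j<d. (v i * v j) * (\<integral>x. x i * x j \<partial>uniform_usphere d))"
    unfolding eq using assms
    by (simp add: Bochner_Integration.integral_sum integrable_coord_mult)
  also have "\<dots> = (\<Sum>i<d. \<Sum>j<d. if i = j then v i * v i / real d else 0)"
    by (intro sum.cong refl) (auto simp: integral_coord_mult_distinct integral_coord_square)
  also have "\<dots> = ip d v v / real d"
    by (simp add: ip_def sum_divide_distrib)
  finally show "(\<integral>x. (ip d x v)\<^sup>2 \<partial>uniform_usphere d) = ip d v v / real d" .
qed

subsection \<open>The exponential moment of the shortest solution\<close>

text \<open>For orthogonal \<open>z\<close> this is a squared residual norm by
  \<open>ip_residual\<close>; in this expanded form its mean can be taken term by term.\<close>

definition sq_res :: "nat \<Rightarrow> nat \<Rightarrow> (nat \<Rightarrow> nat \<Rightarrow> real) \<Rightarrow> (nat \<Rightarrow> real) \<Rightarrow> real" where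
  "sq_res d k z x = ip d x x - (\<Sum>j<k. (ip d x (z j))\<^sup>2 / ip d (z j) (z j))"

lemma borel_measurable_sq_res [measurable]: "sq_res d k z \<in> borel_measurable borel"
  unfolding sq_res_def by measurable

text \<open>Markov's inequality at twice the mean costs at most 1/2. The residual is even in
  \<open>x\<close>, so the two opposite half-spaces share the remaining mass equally and each
  receives at least 1/4.\<close>

lemma measure_small_residual:
  assumes "k < d" and orth: "\<And>i j. i < k \<Longrightarrow> j < i \<Longrightarrow> ip d (z i) (z j) = 0"
    and nz: "\<And>j. j < k \<Longrightarrow> ip d (z j) (z j) \<noteq> 0"
  shows "1 / 4 \<le> measure (uniform_usphere d)
    {x. sq_res d k z x \<le> 2 * (real (d - k) / real d) \<and> ip d x y \<le> 0}"
proof -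
  let ?U = "uniform_usphere d"
  have d: "0 < d" using assms by simp
  interpret prob_space ?U
    by (rule prob_space_uniform_usphere[OF d])
  define q where "q = real (d - k) / real d"
  have q: "0 < q" using \<open>k < d\<close> by (simp add: q_def)
  have AE1: "AE x in ?U. ip d x x = 1"
    using AE_uniform_usphere[OF d] by eventually_elim (simp add: usphere_def)
  have int1: "integrable ?U (\<lambda>x. ip d x x)"
    unfolding ip_def using d by (intro Bochner_Integration.integrable_sum integrable_coord_mult)
  have int: "integrable ?U (sq_res d k z)"
    unfolding sq_res_def
    by (intro Bochner_Integration.integrable_diff Bochner_Integration.integrable_sum
        integrable_divide_zero integrable_ip_square[OF d] int1)
  have "(\<integral>x. sq_res d k z x \<partial>?U) = (\<integral>x. ip d x x \<partial>?U) - (\<Sum>j<k. (\<integral>x. (ip d x (z j))\<^sup>2 \<partial>?U) / ip d (z j) (z j))"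
    unfolding sq_res_def
    by (subst Bochner_Integration.integral_diff)
      (auto intro!: int1 Bochner_Integration.integrable_sum integrable_divide_zero integrable_ip_square[OF d]
        simp: Bochner_Integration.integral_sum integrable_ip_square[OF d])
  also have "(\<integral>x. ip d x x \<partial>?U) = (\<integral>x. (1::real) \<partial>?U)"
    by (rule integral_cong_AE) (use AE1 in auto)
  also have "\<dots> = 1"
    using prob_space by simp
  also have "(\<Sum>j<k. (\<integral>x. (ip d x (z j))\<^sup>2 \<partial>?U) / ip d (z j) (z j)) = (\<Sum>j<k. 1 / real d)"
    using nz by (intro sum.cong) (auto simp: integral_ip_square[OF d])
  \<comment> \<open>Each of the \<open>k\<close> nonzero directions removes \<open>1 / d\<close>
    from the mean 1.\<close>
  also have "1 - \<dots> = q"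
    using \<open>k < d\<close> by (simp add: q_def field_simps of_nat_diff)
  finally have mean: "(\<integral>x. sq_res d k z x \<partial>?U) = q" .
  have nonneg: "0 \<le> sq_res d k z x" for x
    unfolding sq_res_def by (subst ip_residual[OF orth, symmetric]) auto
  have "measure ?U {x \<in> space ?U. sq_res d k z x \<ge> 2 * q} \<le> (\<integral>x. sq_res d k z x \<partial>?U) / (2 * q)"
    using q nonneg by (intro integral_Markov_inequality_measure[of _ _ UNIV] int) auto
  also have "\<dots> = 1 / 2"
    using q by (simp add: mean)
  finally have markov: "measure ?U {x. sq_res d k z x \<ge> 2 * q} \<le> 1 / 2"
    by simp
  let ?A = "\<lambda>\<sigma>. {x. sq_res d k z x \<le> 2 * q \<and> \<sigma> * ip d x y \<le> 0}"
  have [measurable]: "?A \<sigma> \<in> sets borel" for \<sigma>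
    by measurable
  \<comment> \<open>The large-residual set and the two half-space events cover the space, and the
    latter two have the same measure by reflection.\<close>
  have "1 = measure ?U UNIV"
    using prob_space by simp
  also have "\<dots> \<le> measure ?U ({x. sq_res d k z x \<ge> 2 * q} \<union> (?A 1 \<union> ?A (- 1)))"
    by (rule finite_measure_mono) auto
  also have "\<dots> \<le> measure ?U {x. sq_res d k z x \<ge> 2 * q} + measure ?U (?A 1 \<union> ?A (- 1))"
    by (rule measure_Un_le) auto
  also have "measure ?U (?A 1 \<union> ?A (- 1)) \<le> measure ?U (?A 1) + measure ?U (?A (- 1))"
    by (rule measure_Un_le) auto
  also have "measure ?U (?A (- 1)) = measure ?U (?A 1)"
  proof -
    let ?m = "signed_perm (\<lambda>_. - 1) id"
    have ipm: "ip d (?m x) v = - ip d x v" "ip d (?m x) (?m x) = ip d x x" for x v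
      by (simp_all add: ip_def signed_perm_def sum_negf)
    have "measure ?U (?A 1) = measure (distr ?U borel ?m) (?A 1)"
      by (simp add: distr_uniform_usphere_signed_perm permutes_id)
    also have "\<dots> = measure ?U (?m -` ?A 1)"
      by (subst measure_distr) auto
    also have "?m -` ?A 1 = ?A (- 1)"
    proof -
      have "sq_res d k z (?m x) = sq_res d k z x" for x
        unfolding sq_res_def ipm(2) by (simp add: ipm(1))
      then show ?thesis
        by (auto simp: ipm)
    qed
    finally show ?thesis ..
  qed
  finally show ?thesis
    using markov by (simp add: q_def)
qed

text \<open>The new point multiplies the exponential by a factor at most 1. On \<open>A\<close> the
  numerator of the increment is at least 1 and its denominator at most
  \<open>2 * (d - k) / d\<close>, so the factor is at most \<open>c\<close>.\<close>

lemma indep_exp_fun_upd_le: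
  fixes x :: "nat \<Rightarrow> nat \<Rightarrow> real"
  assumes \<mu>: "0 \<le> \<mu>" and "k < d"
  defines "c \<equiv> exp (- \<mu> / (2 * (real (d - k) / real d)))"
  defines "A \<equiv> {X. sq_res d k (gs d x) X \<le> 2 * (real (d - k) / real d)
      \<and> ip d X (\<Sum>j<k. (gcoord d x j / ip d (gs d x j) (gs d x j)) *\<^sub>R gs d x j) \<le> 0}"
  shows "indep_exp d \<mu> (Suc k) (x(k := X)) \<le> indep_exp d \<mu> k x * (1 - (1 - c) * indicator A X)"
proof -
  let ?x = "x(k := X)"
  \<comment> \<open>If no residual vanishes, \<open>Y\<close> is the shortest solution of the first
    \<open>k\<close> equations, and the new coordinate is \<open>1 - ip d X Y\<close>.\<close>
  define Y where "Y = (\<Sum>j<k. (gcoord d x j / ip d (gs d x j) (gs d x j)) *\<^sub>R gs d x j)"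
  define R where "R = sq_res d k (gs d x) X"
  have gs: "gs d ?x j = gs d x j" if "j < k" for j
    using that by (intro gs_cong) auto
  have gc: "gcoord d ?x j = gcoord d x j" if "j < k" for j
    using that by (intro gcoord_cong) auto
  have R: "ip d (gs d ?x k) (gs d ?x k) = R"
    by (subst ip_gs_self) (simp add: R_def sq_res_def gs)
  have Y: "gcoord d ?x k = 1 - ip d X Y"
    by (subst gcoord.simps) (simp add: Y_def ip_commute[of d X "sum _ _"] ip_linear gs gc ip_commute[of d _ X] mult.commute)
  have q: "0 < real (d - k) / real d"
    using \<open>k < d\<close> by simp
  have c: "0 < c" "c \<le> 1"
    using \<mu> q by (auto simp: c_def)
  have mn: "min_norm2 d (Suc k) ?x = min_norm2 d k x + (1 - ip d X Y)\<^sup>2 / R"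
    by (simp add: min_norm2_def R Y gs gc)
  show ?thesis
  proof (cases "(\<forall>j<k. ip d (gs d x j) (gs d x j) \<noteq> 0) \<and> R \<noteq> 0")
    case True
    have "0 \<le> R"
      unfolding R[symmetric] by simp
    with True have "0 < R" by simp
    have "exp (- \<mu> * ((1 - ip d X Y)\<^sup>2 / R)) \<le> 1 - (1 - c) * indicator A X"
    proof (cases "X \<in> A")
      case True
      then have le: "R \<le> 2 * (real (d - k) / real d)" "ip d X Y \<le> 0"
        by (auto simp: A_def R_def Y_def)
      have "1 / (2 * (real (d - k) / real d)) \<le> (1 - ip d X Y)\<^sup>2 / R"
        using \<open>0 < R\<close> le(2) by (intro frac_le le(1)) auto
      then have "\<mu> * (1 / (2 * (real (d - k) / real d))) \<le> \<mu> * ((1 - ip d X Y)\<^sup>2 / R)"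
        using \<mu> by (rule mult_left_mono)
      with True show ?thesis
        by (simp add: c_def)
    next
      case False
      then show ?thesis
        using \<mu> \<open>0 < R\<close> by simp
    qed
    then have "exp (- \<mu> * min_norm2 d k x) * exp (- \<mu> * ((1 - ip d X Y)\<^sup>2 / R))
        \<le> exp (- \<mu> * min_norm2 d k x) * (1 - (1 - c) * indicator A X)"
      by (intro mult_left_mono) auto
    moreover have "indep_exp d \<mu> (Suc k) ?x
        = exp (- \<mu> * min_norm2 d k x) * exp (- \<mu> * ((1 - ip d X Y)\<^sup>2 / R))"
      using True by (simp add: indep_exp_def less_Suc_eq gs R mn exp_add[symmetric] distrib_left)
    moreover have "indep_exp d \<mu> k x = exp (- \<mu> * min_norm2 d k x)"
      using True by (simp add: indep_exp_def)
    ultimately show ?thesis by simp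
  next
    case False
    \<comment> \<open>A vanishing residual, old or new, puts the left side at its default value
      0.\<close>
    then have "\<exists>j<Suc k. ip d (gs d ?x j) (gs d ?x j) = 0"
      using R gs by (metis less_SucI lessI)
    then have "indep_exp d \<mu> (Suc k) ?x = 0"
      by (auto simp: indep_exp_def)
    moreover have "0 \<le> indep_exp d \<mu> k x * (1 - (1 - c) * indicator A X)"
      using c by (auto simp: indep_exp_def indicator_def)
    ultimately show ?thesis by simp
  qed
qed

lemma nn_integral_indep_exp_step:
  assumes \<mu>: "0 \<le> \<mu>" and "k < d"
  shows "(\<integral>\<^sup>+X. indep_exp d \<mu> (Suc k) (x(k := X)) \<partial>uniform_usphere d)
    \<le> ennreal (1 - (1 - exp (- \<mu> / (2 * (real (d - k) / real d)))) / 4) * ennreal (indep_exp d \<mu> k x)"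
proof (cases "\<forall>j<k. ip d (gs d x j) (gs d x j) \<noteq> 0")
  case True
  let ?U = "uniform_usphere d"
  interpret prob_space ?U
    using assms by (intro prob_space_uniform_usphere) simp
  define c where "c = exp (- \<mu> / (2 * (real (d - k) / real d)))"
  define A where "A = {X. sq_res d k (gs d x) X \<le> 2 * (real (d - k) / real d)
      \<and> ip d X (\<Sum>j<k. (gcoord d x j / ip d (gs d x j) (gs d x j)) *\<^sub>R gs d x j) \<le> 0}"
  have c: "0 < c" "c \<le> 1"
    using \<mu> by (auto simp: c_def)
  have f: "0 \<le> indep_exp d \<mu> k x"
    by (simp add: indep_exp_def)
  have [measurable]: "A \<in> sets borel"
    unfolding A_def by measurable
  have A: "1 / 4 \<le> measure ?U A"
    unfolding A_def using True \<open>k < d\<close>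
    by (intro measure_small_residual) (auto intro: gs_orthogonal)
  have "(\<integral>\<^sup>+X. indep_exp d \<mu> (Suc k) (x(k := X)) \<partial>?U)
      \<le> (\<integral>\<^sup>+X. ennreal (indep_exp d \<mu> k x * (1 - (1 - c) * indicator A X)) \<partial>?U)"
    unfolding A_def c_def
    by (intro nn_integral_mono ennreal_leI indep_exp_fun_upd_le assms)
  also have "\<dots> = ennreal (\<integral>X. indep_exp d \<mu> k x * (1 - (1 - c) * indicator A X) \<partial>?U)"
  proof (rule nn_integral_eq_integral)
    show "integrable ?U (\<lambda>X. indep_exp d \<mu> k x * (1 - (1 - c) * indicator A X))"
      by (intro integrable_mult_right Bochner_Integration.integrable_diff) (auto simp: emeasure_eq_measure)
    show "AE X in ?U. 0 \<le> indep_exp d \<mu> k x * (1 - (1 - c) * indicator A X)"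
      using c f by (auto simp: indicator_def)
  qed
  also have "(\<integral>X. indep_exp d \<mu> k x * (1 - (1 - c) * indicator A X) \<partial>?U)
      = indep_exp d \<mu> k x * (1 - (1 - c) * measure ?U A)"
    using prob_space by (subst Bochner_Integration.integral_mult_right_zero, subst Bochner_Integration.integral_diff)
      (auto simp: emeasure_eq_measure)
  also have "ennreal \<dots> \<le> ennreal ((1 - (1 - c) / 4) * indep_exp d \<mu> k x)"
    using mult_left_mono[OF A, of "1 - c"] c f
    by (subst mult.commute) (intro ennreal_leI mult_right_mono, auto)
  also have "\<dots> = ennreal (1 - (1 - c) / 4) * ennreal (indep_exp d \<mu> k x)"
    using c f by (intro ennreal_mult) auto
  finally show ?thesis
    unfolding c_def .
next
  case False
  then obtain j where j: "j < k" "ip d (gs d x j) (gs d x j) = 0" by auto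
  have "indep_exp d \<mu> (Suc k) (x(k := X)) = 0" for X
  proof -
    have "gs d (x(k := X)) j = gs d x j"
      using j by (intro gs_cong) auto
    with j have "\<not> (\<forall>j<Suc k. ip d (gs d (x(k := X)) j) (gs d (x(k := X)) j) \<noteq> 0)"
      by (metis less_SucI)
    then show ?thesis
      unfolding indep_exp_def by (rule if_not_P)
  qed
  then show ?thesis by simp
qed

text \<open>The one-step factor does not depend on the earlier points, so integrating the last point
  first by Fubini pulls out a constant.\<close>

lemma nn_integral_indep_exp:
  assumes \<mu>: "0 \<le> \<mu>" and "k \<le> d" "0 < d"
  shows "(\<integral>\<^sup>+x. indep_exp d \<mu> k x \<partial>Pi\<^sub>M {..<k} (\<lambda>_. uniform_usphere d))
    \<le> ennreal (\<Prod>j<k. 1 - (1 - exp (- \<mu> / (2 * (real (d - j) / real d)))) / 4)"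
  using \<open>k \<le> d\<close>
proof (induction k)
  case 0
  then show ?case
    by (simp add: indep_exp_def min_norm2_def PiM_empty nn_integral_count_space_finite)
next
  case (Suc k)
  let ?U = "\<lambda>_::nat. uniform_usphere d"
  let ?c = "\<lambda>j. 1 - (1 - exp (- \<mu> / (2 * (real (d - j) / real d)))) / 4"
  have prob: "prob_space (uniform_usphere d)"
    using \<open>0 < d\<close> by (rule prob_space_uniform_usphere)
  interpret product_sigma_finite ?U
    using prob by (simp add: product_sigma_finite_def prob_space_imp_sigma_finite)
  have c: "0 \<le> ?c j" for j
    using \<mu> by (simp add: field_simps)
  have meas: "(\<lambda>x. ennreal (indep_exp d \<mu> l x)) \<in> borel_measurable (Pi\<^sub>M {..<l} ?U)" for l
  proof -
    have "(\<lambda>x. indep_exp d \<mu> l x) \<in> borel_measurable (Pi\<^sub>M {..<l} ?U)"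
    proof (rule measurable_indep_exp)
      fix j assume "j < l"
      then have "(\<lambda>x. x j) \<in> Pi\<^sub>M {..<l} ?U \<rightarrow>\<^sub>M uniform_usphere d"
        by (intro measurable_component_singleton) simp
      then show "(\<lambda>x. x j) \<in> Pi\<^sub>M {..<l} ?U \<rightarrow>\<^sub>M borel"
        by (simp cong: measurable_cong_sets)
    qed
    then show ?thesis by simp
  qed
  have "(\<integral>\<^sup>+x. indep_exp d \<mu> (Suc k) x \<partial>Pi\<^sub>M {..<Suc k} ?U)
      = (\<integral>\<^sup>+x. (\<integral>\<^sup>+X. indep_exp d \<mu> (Suc k) (x(k := X)) \<partial>uniform_usphere d) \<partial>Pi\<^sub>M {..<k} ?U)"
    using meas[of "Suc k"] unfolding lessThan_Suc by (intro product_nn_integral_insert) auto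
  also have "\<dots> \<le> (\<integral>\<^sup>+x. ennreal (?c k) * ennreal (indep_exp d \<mu> k x) \<partial>Pi\<^sub>M {..<k} ?U)"
    using Suc.prems \<mu> by (intro nn_integral_mono nn_integral_indep_exp_step) auto
  also have "\<dots> = ennreal (?c k) * (\<integral>\<^sup>+x. indep_exp d \<mu> k x \<partial>Pi\<^sub>M {..<k} ?U)"
    by (rule nn_integral_cmult[OF meas])
  also have "\<dots> \<le> ennreal (?c k) * ennreal (\<Prod>j<k. ?c j)"
    using Suc by (intro mult_left_mono) auto
  also have "\<dots> = ennreal (\<Prod>j<Suc k. ?c j)"
    using c by (simp add: ennreal_mult' mult.commute prod_nonneg)
  finally show ?case .
qed

subsection \<open>Asymptotics\<close>

lemma indep_exp_cong:
  assumes "\<And>j. j < k \<Longrightarrow> x j = y j"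
  shows "indep_exp d \<mu> k x = indep_exp d \<mu> k y"
proof -
  have "gs d x j = gs d y j" "gcoord d x j = gcoord d y j" if "j < k" for j
    using that assms by (auto intro: gs_cong gcoord_cong)
  then show ?thesis
    by (auto simp: indep_exp_def min_norm2_def)
qed

text \<open>The pointwise form of the Chernoff bound: independence makes all residuals nonzero, and
  the shortest solution is no longer than the given one.\<close>

lemma high_flat_imp_indep_exp_ge:
  assumes hf: "high_flat d s x I" and \<sigma>: "bij_betw \<sigma> {..<d} I" and \<mu>: "0 \<le> \<mu>"
    and R: "\<And>i. i \<in> I \<Longrightarrow> x i \<in> Rdim d"
  shows "1 \<le> exp (\<mu> * s) * indep_exp d \<mu> d (\<lambda>j. x (\<sigma> j))"
proof -
  let ?y = "\<lambda>j. x (\<sigma> j)"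
  obtain y where y: "\<forall>i\<in>I. ip d (x i) y = 1" "ip d y y \<le> s"
    and hf': "inj_on x I" "independent (x ` I)"
    using hf by (auto simp: high_flat_def)
  have \<sigma>I: "\<sigma> j \<in> I" if "j < d" for j
    using \<sigma> that by (auto simp: bij_betw_def)
  have im: "?y ` {..<d} = x ` I"
    using \<sigma> by (auto simp: bij_betw_def image_image)
  have inj: "inj_on ?y {..<d}"
    using comp_inj_on[of \<sigma> "{..<d}" x] \<sigma> hf'(1) by (auto simp: bij_betw_def o_def)
  have nz: "\<forall>j<d. ip d (gs d ?y j) (gs d ?y j) \<noteq> 0"
  proof (intro allI impI)
    fix j assume "j < d"
    show "ip d (gs d ?y j) (gs d ?y j) \<noteq> 0"
    proof (rule gs_nonzero[of ?y d])
      show "independent (?y ` {..<d})"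
        unfolding im by (rule hf')
    qed (use inj R \<sigma>I \<open>j < d\<close> in auto)
  qed
  have "min_norm2 d d ?y \<le> ip d y y"
    using y \<sigma>I by (intro min_norm2_le) auto
  also have "\<dots> \<le> s" by (rule y)
  finally have "\<mu> * min_norm2 d d ?y \<le> \<mu> * s"
    using \<mu> by (rule mult_left_mono)
  then show ?thesis
    using nz by (simp add: indep_exp_def exp_add[symmetric])
qed

text \<open>The joint law of the sample is a product measure, and selecting \<open>d\<close>
  distinct coordinates of it gives the product of \<open>d\<close> copies.\<close>

lemma nn_integral_indep_exp_subset:
  assumes M: "prob_space M" and indep: "prob_space.indep_vars M (\<lambda>_. borel) X {..<n::nat}"
    and unif: "\<And>i. i < n \<Longrightarrow> distr M borel (X i) = uniform_usphere d"
    and \<sigma>: "inj_on \<sigma> {..<d}" "\<sigma> ` {..<d} \<subseteq> {..<n}" and "0 < d"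
  shows "(\<integral>\<^sup>+\<omega>. indep_exp d \<mu> d (\<lambda>j. X (\<sigma> j) \<omega>) \<partial>M)
    = (\<integral>\<^sup>+x. indep_exp d \<mu> d x \<partial>Pi\<^sub>M {..<d} (\<lambda>_. uniform_usphere d))"
proof -
  interpret prob_space M by fact
  let ?U = "\<lambda>_::nat. uniform_usphere d"
  let ?B = "\<lambda>_::nat. borel :: (nat \<Rightarrow> real) measure"
  have "0 < n"
    using \<sigma>(2) \<open>0 < d\<close> by auto
  have X [measurable]: "X i \<in> M \<rightarrow>\<^sub>M borel" if "i < n" for i
    using indep that by (auto simp: indep_vars_def2)
  have PiU: "Pi\<^sub>M {..<n} (\<lambda>i. distr M borel (X i)) = Pi\<^sub>M {..<n} ?U"
    using unif by (intro PiM_cong) auto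
  have sets: "sets (Pi\<^sub>M J ?U) = sets (Pi\<^sub>M J ?B)" for J
    by (intro sets_PiM_cong) auto
  have joint: "distr M (Pi\<^sub>M {..<n} ?B) (\<lambda>\<omega>. \<lambda>i\<in>{..<n}. X i \<omega>) = Pi\<^sub>M {..<n} ?U"
    using indep_vars_iff_distr_eq_PiM'[where I = "{..<n}" and X = X and M' = ?B] indep X \<open>0 < n\<close> PiU by auto
  have meas: "(\<lambda>x. ennreal (indep_exp d \<mu> d x)) \<in> borel_measurable (Pi\<^sub>M {..<d} ?B)"
    by (intro measurable_compose[OF measurable_indep_exp measurable_ennreal] measurable_component_singleton) simp
  have re: "(\<lambda>x. \<lambda>j\<in>{..<d}. x (\<sigma> j)) \<in> Pi\<^sub>M {..<n} ?B \<rightarrow>\<^sub>M Pi\<^sub>M {..<d} ?B"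
    using \<sigma> by (intro measurable_restrict measurable_component_singleton) auto
  have re': "(\<lambda>x. \<lambda>j\<in>{..<d}. x (\<sigma> j)) \<in> Pi\<^sub>M {..<n} ?U \<rightarrow>\<^sub>M Pi\<^sub>M {..<d} ?U"
    using re unfolding measurable_cong_sets[OF sets sets] .
  have meas': "(\<lambda>x. ennreal (indep_exp d \<mu> d x)) \<in> borel_measurable (Pi\<^sub>M {..<d} ?U)"
    using meas unfolding measurable_cong_sets[OF sets refl] .
  have mX: "(\<lambda>\<omega>. \<lambda>i\<in>{..<n}. X i \<omega>) \<in> M \<rightarrow>\<^sub>M Pi\<^sub>M {..<n} ?B"
    by (intro measurable_restrict X) simp
  \<comment> \<open>Only the first \<open>d\<close> points are read, so restricting to the index set
    of the product space changes nothing.\<close>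
  have "(\<integral>\<^sup>+\<omega>. indep_exp d \<mu> d (\<lambda>j. X (\<sigma> j) \<omega>) \<partial>M)
      = (\<integral>\<^sup>+\<omega>. indep_exp d \<mu> d (\<lambda>j\<in>{..<d}. (\<lambda>i\<in>{..<n}. X i \<omega>) (\<sigma> j)) \<partial>M)"
    using \<sigma> by (intro nn_integral_cong arg_cong[of _ _ ennreal] indep_exp_cong) auto
  also have "\<dots> = (\<integral>\<^sup>+x. indep_exp d \<mu> d (\<lambda>j\<in>{..<d}. x (\<sigma> j)) \<partial>distr M (Pi\<^sub>M {..<n} ?B) (\<lambda>\<omega>. \<lambda>i\<in>{..<n}. X i \<omega>))"
    using measurable_compose[OF re meas] by (intro nn_integral_distr[symmetric, OF mX]) simp
  also have "\<dots> = (\<integral>\<^sup>+x. indep_exp d \<mu> d (\<lambda>j\<in>{..<d}. x (\<sigma> j)) \<partial>Pi\<^sub>M {..<n} ?U)"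
    unfolding joint ..
  also have "\<dots> = (\<integral>\<^sup>+x. indep_exp d \<mu> d x \<partial>distr (Pi\<^sub>M {..<n} ?U) (Pi\<^sub>M {..<d} ?U) (\<lambda>x. \<lambda>j\<in>{..<d}. x (\<sigma> j)))"
    using meas' by (intro nn_integral_distr[symmetric, OF re']) simp
  also have "distr (Pi\<^sub>M {..<n} ?U) (Pi\<^sub>M {..<d} ?U) (\<lambda>x. \<lambda>j\<in>{..<d}. x (\<sigma> j)) = Pi\<^sub>M {..<d} ?U"
    using \<sigma> prob_space_uniform_usphere[OF \<open>0 < d\<close>] by (intro distr_PiM_reindex) auto
  finally show ?thesis .
qed

text \<open>The facet count is at most the number of \<open>d\<close>-subsets satisfying
  \<open>high_flat\<close>. Each such indicator is dominated by its exponential, and all subsets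
  have the same exponential moment.\<close>

lemma expected_facets_le:
  assumes M: "prob_space M" and indep: "prob_space.indep_vars M (\<lambda>_. borel) X {..<n::nat}"
    and unif: "\<And>i. i < n \<Longrightarrow> distr M borel (X i) = uniform_usphere d"
    and "0 < d" and \<mu>: "0 \<le> \<mu>" and H: "\<And>h. h \<in> {h1..h2} \<Longrightarrow> h \<noteq> 0 \<and> 1 / h\<^sup>2 \<le> s"
  shows "expected_facets M X n d h1 h2 \<le> ennreal (real (n choose d) *
    (exp (\<mu> * s) * (\<Prod>j<d. 1 - (1 - exp (- \<mu> / (2 * (real (d - j) / real d)))) / 4)))"
proof -
  interpret prob_space M by fact
  let ?P = "\<Prod>j<d. 1 - (1 - exp (- \<mu> / (2 * (real (d - j) / real d)))) / 4"
  define S where "S = {I. I \<subseteq> {..<n} \<and> card I = d}"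
  have fin: "finite S"
    unfolding S_def by (rule finite_subset[of _ "Pow {..<n}"]) auto
  have X [measurable]: "X i \<in> M \<rightarrow>\<^sub>M borel" if "i < n" for i
    using indep that by (auto simp: indep_vars_def2)
  have "\<exists>\<sigma>. bij_betw \<sigma> {..<d} I" if "I \<in> S" for I
    using that ex_bij_betw_nat_finite[of I] finite_subset[of I "{..<n}"]
    by (auto simp: S_def atLeast0LessThan)
  then obtain \<sigma> where \<sigma>: "\<And>I. I \<in> S \<Longrightarrow> bij_betw (\<sigma> I) {..<d} I"
    by metis
  have \<sigma>n: "\<sigma> I j < n" if "I \<in> S" "j < d" for I j
    using \<sigma>[OF that(1)] that by (auto simp: bij_betw_def S_def)
  let ?g = "\<lambda>I \<omega>. ennreal (exp (\<mu> * s)) * ennreal (indep_exp d \<mu> d (\<lambda>j. X (\<sigma> I j) \<omega>))"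
  have meas: "(\<lambda>\<omega>. ennreal (indep_exp d \<mu> d (\<lambda>j. X (\<sigma> I j) \<omega>))) \<in> borel_measurable M" if "I \<in> S" for I
    using \<sigma>n[OF that] by (intro measurable_compose[OF measurable_indep_exp measurable_ennreal] X)
  have "AE \<omega> in M. X i \<omega> \<in> usphere d" if "i < n" for i
    by (rule AE_distrD[OF X[OF that]]) (simp only: unif[OF that] AE_uniform_usphere[OF \<open>0 < d\<close>])
  \<comment> \<open>The points lie on the sphere, hence in \<open>Rdim d\<close>, only almost
    surely; the comparison below is made on this event.\<close>
  then have AE: "AE \<omega> in M. \<forall>i\<in>{..<n}. X i \<omega> \<in> usphere d"
    by (intro AE_finite_allI) auto
  have "expected_facets M X n d h1 h2 \<le> (\<integral>\<^sup>+\<omega>. (\<Sum>I\<in>S. ?g I \<omega>) \<partial>M)"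
    unfolding expected_facets_def
  proof (rule nn_integral_mono_AE, use AE in eventually_elim)
    fix \<omega> assume \<omega>: "\<forall>i\<in>{..<n}. X i \<omega> \<in> usphere d"
    let ?x = "\<lambda>i. X i \<omega>"
    have "card {T. \<exists>h\<in>{h1..h2}. facet_with_height d (convex hull (?x ` {..<n})) h T}
        \<le> card {I. I \<subseteq> {..<n} \<and> card I = d \<and> high_flat d s ?x I}"
      using H by (rule card_facets_le)
    also have "\<dots> = (\<Sum>I\<in>{I. I \<subseteq> {..<n} \<and> card I = d \<and> high_flat d s ?x I}. 1)"
      by simp
    also have "\<dots> = (\<Sum>I\<in>S. if high_flat d s ?x I then 1 else 0)"
      using fin by (subst sum.inter_filter[symmetric]) (auto simp: S_def intro!: sum.cong)
    finally have "of_nat (card {T. \<exists>h\<in>{h1..h2}. facet_with_height d (convex hull (?x ` {..<n})) h T})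
        \<le> (of_nat (\<Sum>I\<in>S. if high_flat d s ?x I then 1 else 0) :: ennreal)"
      by (rule of_nat_mono)
    also have "\<dots> = (\<Sum>I\<in>S. if high_flat d s ?x I then 1 else 0)"
      unfolding of_nat_sum by (intro sum.cong) auto
    also have "\<dots> \<le> (\<Sum>I\<in>S. ?g I \<omega>)"
    proof (rule sum_mono)
      fix I assume I: "I \<in> S"
      show "(if high_flat d s ?x I then 1 else 0) \<le> ?g I \<omega>"
      proof (cases "high_flat d s ?x I")
        case True
        have "1 \<le> exp (\<mu> * s) * indep_exp d \<mu> d (\<lambda>j. ?x (\<sigma> I j))"
          using \<omega> I by (intro high_flat_imp_indep_exp_ge[OF True \<sigma>[OF I] \<mu>]) (auto simp: S_def usphere_def)
        then have "ennreal 1 \<le> ennreal (exp (\<mu> * s) * indep_exp d \<mu> d (\<lambda>j. ?x (\<sigma> I j)))"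
          by (rule ennreal_leI)
        then show ?thesis
          using True by (simp add: ennreal_mult')
      qed simp
    qed
    finally show "of_nat (card {T. \<exists>h\<in>{h1..h2}. facet_with_height d (convex hull (?x ` {..<n})) h T})
        \<le> (\<Sum>I\<in>S. ?g I \<omega>)" .
  qed
  also have "\<dots> = (\<Sum>I\<in>S. \<integral>\<^sup>+\<omega>. ?g I \<omega> \<partial>M)"
    using meas by (intro nn_integral_sum) auto
  also have "\<dots> \<le> (\<Sum>I\<in>S. ennreal (exp (\<mu> * s)) * ennreal ?P)"
  proof (rule sum_mono)
    fix I assume I: "I \<in> S"
    have "(\<integral>\<^sup>+\<omega>. ?g I \<omega> \<partial>M) = ennreal (exp (\<mu> * s)) * (\<integral>\<^sup>+\<omega>. indep_exp d \<mu> d (\<lambda>j. X (\<sigma> I j) \<omega>) \<partial>M)"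
      by (rule nn_integral_cmult[OF meas[OF I]])
    also have "(\<integral>\<^sup>+\<omega>. indep_exp d \<mu> d (\<lambda>j. X (\<sigma> I j) \<omega>) \<partial>M)
        = (\<integral>\<^sup>+x. indep_exp d \<mu> d x \<partial>Pi\<^sub>M {..<d} (\<lambda>_. uniform_usphere d))"
      using \<sigma>[OF I] I \<open>0 < d\<close>
      by (intro nn_integral_indep_exp_subset[OF M indep unif]) (auto simp: bij_betw_def S_def)
    also have "\<dots> \<le> ennreal ?P"
      using \<mu> \<open>0 < d\<close> by (intro nn_integral_indep_exp) auto
    finally show "(\<integral>\<^sup>+\<omega>. ?g I \<omega> \<partial>M) \<le> ennreal (exp (\<mu> * s)) * ennreal ?P"
      by (simp add: mult_left_mono)
  qed
  also have "\<dots> = ennreal (real (n choose d)) * ennreal (exp (\<mu> * s) * ?P)"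
    using n_subsets[of "{..<n}" d] by (simp add: S_def ennreal_mult' ennreal_of_nat_eq_real_of_nat)
  also have "\<dots> = ennreal (real (n choose d) * (exp (\<mu> * s) * ?P))"
    by (simp add: ennreal_mult')
  finally show ?thesis .
qed

section \<open>Estimates for the product and the binomial coefficient\<close>

lemma one_minus_exp_ge:
  assumes "0 \<le> (x::real)"
  shows "x / (1 + x) \<le> 1 - exp (- x)"
proof -
  have "exp (- x) \<le> 1 / (1 + x)"
    using exp_ge_add_one_self[of x] assms by (simp add: exp_minus field_simps)
  also have "\<dots> = 1 - x / (1 + x)"
    using assms by (simp add: field_simps)
  finally show ?thesis by simp
qed

text \<open>With \<open>m = d - j\<close>, each factor is at most the exponential of
  \<open>- (a / 4) / (m + a)\<close>. The sum of \<open>1 / (m + a)\<close> is at least a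
  telescoping sum of logarithms whose total is at least \<open>ln (1 / \<mu>)\<close>.\<close>

lemma product_tail_bound:
  assumes r: "0 < r" and \<mu>: "\<mu> = exp (- (8 / r\<^sup>2 + 8))" and large: "2 \<le> \<mu> * real d"
  shows "exp (\<mu> * (real d / r\<^sup>2)) * (\<Prod>j<d. 1 - (1 - exp (- \<mu> / (2 * (real (d - j) / real d)))) / 4)
    \<le> exp (- (\<mu> * real d))"
proof -
  define a where "a = \<mu> * real d / 2"
  have \<mu>0: "0 < \<mu>" by (simp add: \<mu>)
  have a: "1 \<le> a" using large by (simp add: a_def)
  have d: "0 < d" using large by (cases d) auto
  \<comment> \<open>Chosen so that \<open>f j - f (Suc j)\<close> is
    \<open>ln (1 + 1 / (m + a))\<close>, which is at most \<open>1 / (m + a)\<close>.\<close>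
  define f where "f j = ln (real d - real j + 1 + a)" for j
  have le: "1 - (1 - exp (- \<mu> / (2 * (real (d - j) / real d)))) / 4
      \<le> exp (- (a / 4 * (f j - f (Suc j))))" if j: "j < d" for j
  proof -
    define m where "m = real (d - j)"
    have m: "0 < m" "real d - real j = m"
      using j by (auto simp: m_def of_nat_diff)
    have x: "\<mu> / (2 * (m / real d)) = a / m"
      using d m by (simp add: a_def field_simps)
    have "f j - f (Suc j) = ln ((m + 1 + a) / (m + a))"
      using m a by (simp add: f_def ln_div)
    also have "\<dots> = ln (1 + 1 / (m + a))"
      using m a by (simp add: field_simps)
    also have "\<dots> \<le> 1 / (m + a)"
      using m a by (intro ln_add_one_self_le_self) auto
    finally have "a * (f j - f (Suc j)) \<le> a * (1 / (m + a))"
      using a by (intro mult_left_mono) auto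
    also have "\<dots> = (a / m) / (1 + a / m)"
      using m a by (simp add: field_simps)
    also have "\<dots> \<le> 1 - exp (- (a / m))"
      using m a by (intro one_minus_exp_ge) auto
    finally have "1 - (1 - exp (- (a / m))) / 4 \<le> 1 + (- (a / 4 * (f j - f (Suc j))))"
      by simp
    also have "\<dots> \<le> exp (- (a / 4 * (f j - f (Suc j))))"
      by (rule exp_ge_add_one_self)
    finally show ?thesis
      using x by (simp add: m_def)
  qed
  have "(\<Prod>j<d. 1 - (1 - exp (- \<mu> / (2 * (real (d - j) / real d)))) / 4)
      \<le> (\<Prod>j<d. exp (- (a / 4 * (f j - f (Suc j)))))"
  proof (intro prod_mono conjI)
    fix j assume "j \<in> {..<d}"
    then show "1 - (1 - exp (- \<mu> / (2 * (real (d - j) / real d)))) / 4 \<le> exp (- (a / 4 * (f j - f (Suc j))))"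
      by (intro le) simp
    have "0 < exp (- \<mu> / (2 * (real (d - j) / real d)))"
      by simp
    then show "0 \<le> 1 - (1 - exp (- \<mu> / (2 * (real (d - j) / real d)))) / 4"
      by argo
  qed
  also have "\<dots> = exp (\<Sum>j<d. - (a / 4 * (f j - f (Suc j))))"
    by (rule exp_sum[symmetric]) simp
  also have "(\<Sum>j<d. - (a / 4 * (f j - f (Suc j)))) = - (a / 4) * (f 0 - f d)"
    unfolding sum_negf sum_distrib_left[symmetric] sum_lessThan_telescope' by simp
  finally have prod: "(\<Prod>j<d. 1 - (1 - exp (- \<mu> / (2 * (real (d - j) / real d)))) / 4)
      \<le> exp (- (a / 4) * (f 0 - f d))" .
  \<comment> \<open>Since \<open>a \<ge> 1\<close>, \<open>1 + a\<close> is at most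
    \<open>2 * a = \<mu> * d\<close>; this is where \<open>large\<close> enters.\<close>
  have "1 / \<mu> \<le> (real d + 1 + a) / (1 + a)"
  proof -
    have "1 + a \<le> \<mu> * real d"
      using a by (simp add: a_def)
    also have "\<dots> \<le> \<mu> * (real d + 1 + a)"
      using \<mu>0 a by (intro mult_left_mono) auto
    finally show ?thesis
      using \<mu>0 a by (simp add: field_simps)
  qed
  then have "ln (1 / \<mu>) \<le> ln ((real d + 1 + a) / (1 + a))"
    using \<mu>0 a by (subst ln_le_cancel_iff) auto
  then have "8 / r\<^sup>2 + 8 \<le> f 0 - f d"
    using a by (simp add: f_def ln_div \<mu> ln_div)
  then have "a / 4 * (8 / r\<^sup>2 + 8) \<le> a / 4 * (f 0 - f d)"
    using a by (intro mult_left_mono) auto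
  \<comment> \<open>The first 8 cancels the Chernoff factor and the second leaves the gain
    \<open>\<mu> * d\<close>.\<close>
  moreover have "a / 4 * (8 / r\<^sup>2 + 8) = \<mu> * (real d / r\<^sup>2) + \<mu> * real d"
    by (simp add: a_def field_simps)
  ultimately have "\<mu> * (real d / r\<^sup>2) + - (a / 4) * (f 0 - f d) \<le> - (\<mu> * real d)"
    unfolding minus_mult_left[symmetric] by linarith
  then have "exp (\<mu> * (real d / r\<^sup>2)) * exp (- (a / 4) * (f 0 - f d)) \<le> exp (- (\<mu> * real d))"
    by (simp add: exp_add[symmetric])
  then show ?thesis
    by (rule order_trans[rotated]) (rule mult_left_mono[OF prod], simp)
qed

text \<open>A single term of the expansion of \<open>(1 + x) ^ n\<close>, with the weight
  \<open>x\<close> on the \<open>n - d\<close> omitted points, so that a small codimension costs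
  little.\<close>

lemma binomial_le_exp:
  fixes x :: real
  assumes "d \<le> n" "0 < x"
  shows "real (n choose d) \<le> exp (real n * x + real (n - d) * ln (1 / x))"
proof -
  have "real (n choose d) * x ^ (n - d) \<le> (\<Sum>k\<le>n. real (n choose k) * x ^ (n - k))"
    using assms by (intro member_le_sum[of d]) auto
  also have "\<dots> = (1 + x) ^ n"
    by (simp add: binomial_ring)
  also have "\<dots> \<le> exp x ^ n"
    using assms by (intro power_mono) auto
  also have "\<dots> = exp (real n * x)"
    by (simp add: exp_of_nat_mult)
  finally have "real (n choose d) \<le> exp (real n * x) / x ^ (n - d)"
    using assms by (simp add: field_simps)
  also have "\<dots> = exp (real n * x) * (1 / x) ^ (n - d)"
    by (simp add: power_one_over field_simps)
  also have "(1 / x) ^ (n - d) = exp (real (n - d) * ln (1 / x))"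
    using assms by (subst exp_of_nat_mult) simp
  finally show ?thesis
    by (simp only: exp_add)
qed

text \<open>The binomial coefficient costs at most \<open>exp (\<mu> / 2 * d)\<close> against the
  gain \<open>exp (- \<mu> * d)\<close>; the rest is rewritten with
  \<open>n \<le> 2 * d\<close>.\<close>

lemma expected_facets_le_exp:
  assumes M: "prob_space M" and indep: "prob_space.indep_vars M (\<lambda>_. borel) X {..<n::nat}"
    and unif: "\<And>i. i < n \<Longrightarrow> distr M borel (X i) = uniform_usphere d"
    and "0 < d" "d \<le> n" and r: "0 < r" and \<mu>: "\<mu> = exp (- (8 / r\<^sup>2 + 8))" and large: "2 \<le> \<mu> * real d"
    and codim: "real (n - d) \<le> real d" "real (n - d) * ln (8 / \<mu>) \<le> \<mu> / 4 * real d"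
    and H: "\<And>h. h \<in> {h1..h2} \<Longrightarrow> r / sqrt (real d) \<le> \<bar>h\<bar>"
  shows "expected_facets M X n d h1 h2 \<le> ennreal (exp (- (\<mu> / 4 * real n)))"
proof -
  have \<mu>0: "0 < \<mu>" by (simp add: \<mu>)
  have H': "h \<noteq> 0 \<and> 1 / h\<^sup>2 \<le> real d / r\<^sup>2" if "h \<in> {h1..h2}" for h
  proof
    have pos: "0 < r / sqrt (real d)"
      using r \<open>0 < d\<close> by simp
    with H[OF that] show "h \<noteq> 0" by auto
    have "(r / sqrt (real d))\<^sup>2 \<le> \<bar>h\<bar>\<^sup>2"
      using H[OF that] pos by (intro power_mono) auto
    then have "r\<^sup>2 / real d \<le> h\<^sup>2"
      by (simp add: power_divide)
    then show "1 / h\<^sup>2 \<le> real d / r\<^sup>2"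
      using \<open>h \<noteq> 0\<close> r \<open>0 < d\<close> by (simp add: field_simps)
  qed
  have n: "real n \<le> 2 * real d"
    using codim(1) \<open>d \<le> n\<close> by (simp add: of_nat_diff)
  \<comment> \<open>With \<open>x = \<mu> / 8\<close> each of the two exponents is at most
    \<open>\<mu> / 4 * d\<close>.\<close>
  have "real (n choose d) \<le> exp (real n * (\<mu> / 8) + real (n - d) * ln (1 / (\<mu> / 8)))"
    using \<open>d \<le> n\<close> \<mu>0 by (intro binomial_le_exp) auto
  also have "\<dots> \<le> exp (\<mu> / 2 * real d)"
  proof -
    have "real n * (\<mu> / 8) \<le> \<mu> / 4 * real d"
      using mult_right_mono[OF n, of "\<mu> / 8"] \<mu>0 by simp
    with codim(2) show ?thesis
      by (simp del: of_nat_diff)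
  qed
  finally have choose: "real (n choose d) \<le> exp (\<mu> / 2 * real d)" .
  have "expected_facets M X n d h1 h2 \<le> ennreal (real (n choose d) *
      (exp (\<mu> * (real d / r\<^sup>2)) * (\<Prod>j<d. 1 - (1 - exp (- \<mu> / (2 * (real (d - j) / real d)))) / 4)))"
    using \<mu>0 by (intro expected_facets_le[OF M indep unif \<open>0 < d\<close> _ H']) auto
  also have "\<dots> \<le> ennreal (exp (\<mu> / 2 * real d) * exp (- (\<mu> * real d)))"
  proof (intro ennreal_leI order_trans[OF mult_left_mono mult_right_mono])
    show "exp (\<mu> * (real d / r\<^sup>2)) * (\<Prod>j<d. 1 - (1 - exp (- \<mu> / (2 * (real (d - j) / real d)))) / 4)
        \<le> exp (- (\<mu> * real d))"
      by (rule product_tail_bound[OF r \<mu> large])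
  qed (use choose in auto)
  also have "\<dots> = ennreal (exp (- (\<mu> / 2 * real d)))"
    by (simp add: exp_add[symmetric] field_simps)
  also have "\<dots> \<le> ennreal (exp (- (\<mu> / 4 * real n)))"
    using mult_left_mono[OF n, of "\<mu> / 4"] \<mu>0 by (intro ennreal_leI) (simp add: field_simps)
  finally show ?thesis .
qed

theorem theorem6:
  fixes d :: "nat \<Rightarrow> nat"
    and M :: "nat \<Rightarrow> 'w measure"
    and X :: "nat \<Rightarrow> nat \<Rightarrow> 'w \<Rightarrow> nat \<Rightarrow> real"
    and r :: real
  assumes d_range: "\<And>n. 3 \<le> n \<Longrightarrow> 2 \<le> d n \<and> d n \<le> n - 1"
    and d_growth: "(\<exists>c. \<forall>n\<ge>3. d n = c) \<or> filterlim d at_top sequentially"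
    and prob: "\<And>n. 3 \<le> n \<Longrightarrow> prob_space (M n)"
    and indep: "\<And>n. 3 \<le> n \<Longrightarrow> prob_space.indep_vars (M n) (\<lambda>_. borel) (X n) {..<n}"
    and uniform: "\<And>n i. 3 \<le> n \<Longrightarrow> i < n \<Longrightarrow> distr (M n) borel (X n i) = uniform_usphere (d n)"
    and codim: "(\<lambda>n. (real n - real (d n)) / real (d n)) \<longlonglongrightarrow> 0"
    and r_pos: "0 < r"
  shows "(\<lambda>n. expected_facets (M n) (X n) n (d n) (- 1) (- r / sqrt (real (d n)))) \<longlonglongrightarrow> 0
    \<and> (\<lambda>n. expected_facets (M n) (X n) n (d n) (r / sqrt (real (d n))) 1) \<longlonglongrightarrow> 0"
proof -
  define \<mu> where "\<mu> = exp (- (8 / r\<^sup>2 + 8))"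
  have \<mu>0: "0 < \<mu>" "\<mu> \<le> 1"
    using zero_le_divide_iff[of 8 "r\<^sup>2"] by (auto simp: \<mu>_def intro!: order_trans[of "- (8 / r\<^sup>2)" 0 8])
  then have L: "0 < ln (8 / \<mu>)"
    by (intro ln_gt_zero) (simp add: field_simps)
  \<comment> \<open>The two entries of the minimum give the two codimension bounds of
    \<open>expected_facets_le_exp\<close>.\<close>
  define \<epsilon> where "\<epsilon> = min 1 (\<mu> / 4 / ln (8 / \<mu>))"
  have \<epsilon>: "0 < \<epsilon>"
    using \<mu>0 L by (simp add: \<epsilon>_def)
  have bound: "\<forall>\<^sub>F n in sequentially. 3 \<le> n \<and> 2 \<le> \<mu> * real (d n) \<and> real (n - d n) \<le> real (d n)
      \<and> real (n - d n) * ln (8 / \<mu>) \<le> \<mu> / 4 * real (d n)"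
    using order_tendstoD(2)[OF codim \<epsilon>] eventually_ge_at_top[of 3] eventually_ge_at_top[of "nat \<lceil>4 / \<mu>\<rceil>"]
  proof eventually_elim
    case (elim n)
    have d: "2 \<le> d n" "d n \<le> n - 1"
      using d_range elim by auto
    then have m: "real (n - d n) < \<epsilon> * real (d n)"
      using elim(1) by (simp add: of_nat_diff field_simps)
    also have "\<dots> \<le> 1 * real (d n)"
      by (intro mult_right_mono) (auto simp: \<epsilon>_def)
    finally have le: "real (n - d n) \<le> real (d n)" by simp
    \<comment> \<open>Together with \<open>n \<le> 2 * d\<close> this threshold yields
      \<open>2 \<le> \<mu> * d\<close>.\<close>
    have "4 / \<mu> \<le> real n"
      using elim(3) by linarith
    also have "\<dots> \<le> 2 * real (d n)"
      using le d by (simp add: of_nat_diff)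
    finally have "2 \<le> \<mu> * real (d n)"
      using \<mu>0 by (simp add: field_simps)
    moreover have "real (n - d n) * ln (8 / \<mu>) \<le> (\<mu> / 4 / ln (8 / \<mu>) * real (d n)) * ln (8 / \<mu>)"
    proof (rule mult_right_mono)
      have "\<epsilon> * real (d n) \<le> \<mu> / 4 / ln (8 / \<mu>) * real (d n)"
        by (intro mult_right_mono) (auto simp: \<epsilon>_def)
      with m show "real (n - d n) \<le> \<mu> / 4 / ln (8 / \<mu>) * real (d n)"
        by simp
    qed (use L in simp)
    ultimately show ?case
      using elim le L by simp
  qed
  \<comment> \<open>Only the absolute value of the height matters, so both intervals are instances
    of one limit.\<close>
  have lim: "(\<lambda>n. expected_facets (M n) (X n) n (d n) (h1 n) (h2 n)) \<longlonglongrightarrow> 0"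
    if H: "\<And>n h. h \<in> {h1 n..h2 n} \<Longrightarrow> r / sqrt (real (d n)) \<le> \<bar>h\<bar>" for h1 h2
  proof (rule tendsto_sandwich[OF _ _ tendsto_const])
    show "\<forall>\<^sub>F n in sequentially. 0 \<le> expected_facets (M n) (X n) n (d n) (h1 n) (h2 n)"
      by simp
    show "\<forall>\<^sub>F n in sequentially. expected_facets (M n) (X n) n (d n) (h1 n) (h2 n)
        \<le> ennreal (exp (- (\<mu> / 4 * real n)))"
      using bound
    proof eventually_elim
      case (elim n)
      then have "0 < d n" "d n \<le> n"
        using d_range[of n] by auto
      with elim show ?case
        by (intro expected_facets_le_exp[OF prob indep uniform _ _ r_pos \<mu>_def _ _ _ H]) auto
    qed
    have "filterlim (\<lambda>n. \<mu> / 4 * real n) at_top sequentially"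
      using \<mu>0 by (intro filterlim_tendsto_pos_mult_at_top[OF tendsto_const] filterlim_real_sequentially) simp
    then have "(\<lambda>n. exp (- (\<mu> / 4 * real n))) \<longlonglongrightarrow> 0"
      by (intro filterlim_compose[OF exp_at_bot] filterlim_uminus_at_bot[THEN iffD2]) simp
    then have "(\<lambda>n. ennreal (exp (- (\<mu> / 4 * real n)))) \<longlonglongrightarrow> ennreal 0"
      by (rule tendsto_ennrealI)
    then show "(\<lambda>n. ennreal (exp (- (\<mu> / 4 * real n)))) \<longlonglongrightarrow> 0"
      by simp
  qed
  show ?thesis
    by (intro conjI lim) (auto simp: abs_if)
qed

end
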